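(* Let $\mathbb{F}$ be any field with $\operatorname{char}\mathbb{F}\neq 2$, and let $n\ge 2$. Then $$\mathscr{P}(M_n(\mathbb{F})^+)=(M_n(\mathbb{F})\setminus\mathbb{F}I_n)\cup\{0,I_n\},$$ and $$1+\lceil\log_2 n\rceil\le w(M_n(\mathbb{F})^+)\le 2+5\lceil\log_2 n\rceil.$$ If $\mathbb{F}$ is quadratically closed, the upper bound improves to $$w(M_n(\mathbb{F})^+)\le 4+3\lceil\log_2 n\rceil.$$
   Context: $M_n(\mathbb{F})^+$ is the space of $n\times n$ matrices over $\mathbb{F}$ with the Jordan product $X\circ Y=\frac12(XY+YX)$; its unit is $I_n$. A field of characteristic $\neq2$ is quadratically closed if every polynomial of degree two over it has a root in it (equivalently, every element is a square). Idempotent words: let $\mathcal{J}$ be a unital Jordan algebra with product $\circ$. An idempotent is $e\in\mathcal{J}$ with $e\circ e=e$. An idempotent word of length $m\ge 1$ is a left-nested product $(\cdots((e_1\circ e_2)\circ e_3)\circ\cdots)\circ e_m$ with all $e_i$ idempotents (for $m=1$ it is $e_1$). $\mathscr{P}(\mathcal{J})$ is the set of all values of idempotent words. For $x\in\mathscr{P}(\mathcal{J})$, $\ell_{\mathcal{J}}(x)$ is the minimal length of an idempotent word with value $x$, and $w(\mathcal{J})=\sup_{x\in\mathscr{P}(\mathcal{J})}\ell_{\mathcal{J}}(x)$ (possibly infinite). *)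

theory Defs
  imports
    "Jordan_Normal_Form.Matrix"
    "HOL-Computational_Algebra.Computational_Algebra"
    "HOL-Library.Extended_Nat"
begin

text \<open>
  An algebra is given by its carrier \<open>J\<close> and its product \<open>p\<close>.  The notions of idempotent,
  idempotent word, length and width depend on nothing else, so the unital Jordan algebra axioms are
  not assumed in the definitions.
\<close>

definition idempotents :: "'a set \<Rightarrow> ('a \<Rightarrow> 'a \<Rightarrow> 'a) \<Rightarrow> 'a set" where
  "idempotents J p = {e \<in> J. p e e = e}"

definition idempotent_words :: "'a set \<Rightarrow> ('a \<Rightarrow> 'a \<Rightarrow> 'a) \<Rightarrow> 'a list set" where
  "idempotent_words J p = {es. es \<noteq> [] \<and> set es \<subseteq> idempotents J p}"

text \<open>The left-nested product of a nonempty list: \<open>[e1, e2, e3]\<close> has value \<open>p (p e1 e2) e3\<close>.\<close>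

definition word_value :: "('a \<Rightarrow> 'a \<Rightarrow> 'a) \<Rightarrow> 'a list \<Rightarrow> 'a" where
  "word_value p es = foldl p (hd es) (tl es)"

definition idempotent_products :: "'a set \<Rightarrow> ('a \<Rightarrow> 'a \<Rightarrow> 'a) \<Rightarrow> 'a set" where
  "idempotent_products J p = word_value p ` idempotent_words J p"

text \<open>Only meaningful for \<open>x \<in> idempotent_products J p\<close>.\<close>

definition idempotent_length :: "'a set \<Rightarrow> ('a \<Rightarrow> 'a \<Rightarrow> 'a) \<Rightarrow> 'a \<Rightarrow> nat" where
  "idempotent_length J p x =
    (LEAST m. \<exists>es \<in> idempotent_words J p. length es = m \<and> word_value p es = x)"

definition idempotent_width :: "'a set \<Rightarrow> ('a \<Rightarrow> 'a \<Rightarrow> 'a) \<Rightarrow> enat" where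
  "idempotent_width J p = (SUP x \<in> idempotent_products J p. enat (idempotent_length J p x))"

text \<open>\<open>M\<^sub>n(F)\<^sup>+\<close> is \<open>carrier_mat n n\<close> with the following product.\<close>

definition jordan_product :: "'a::field mat \<Rightarrow> 'a mat \<Rightarrow> 'a mat" where
  "jordan_product X Y = (1 / 2) \<cdot>\<^sub>m (X * Y + Y * X)"

definition quadratically_closed :: "'a::field itself \<Rightarrow> bool" where
  "quadratically_closed _ \<longleftrightarrow> (\<forall>q :: 'a poly. degree q = 2 \<longrightarrow> (\<exists>x. poly q x = 0))"

end

theory Submission
  imports Defs "Jordan_Normal_Form.Determinant" "HOL-Combinatorics.Transposition"
begin

text \<open>
  Let \<open>e\<close> be an idempotent and split the space as \<open>im e \<oplus> ker e\<close>.  The map \<open>C \<mapsto> C \<circ> e\<close> keeps the first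
  diagonal block of \<open>C\<close>, halves the two off-diagonal blocks and kills the second diagonal block.
  So \<open>A\<close> has the form \<open>C \<circ> e\<close> exactly if its second diagonal block is zero, and then \<open>C\<close> is \<open>A\<close> with
  doubled off-diagonal blocks and with an arbitrary second diagonal block.  Words are read
  backwards: a matrix is conjugated until a corner block is zero, this block is replaced at will, and
  so on until an idempotent is reached.  The relation \<open>reduces\<close> records the number of these steps;
  \<open>m\<close> steps give a word of length \<open>m + 1\<close>.

  \<^emph>\<open>Scalar matrices.\<close>  If \<open>c I = C \<circ> e\<close> with \<open>c \<noteq> 0\<close>, the vanishing corner forces \<open>e = I\<close>, so \<open>c I\<close> is
  the value of a shorter word, and in the end \<open>c I\<close> is itself an idempotent.

  \<^emph>\<open>Lower bound.\<close>  A step backwards at most doubles the rank of \<open>A - 2 I\<close>: if this rank is \<open>r\<close>, the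
  vanishing corner forces \<open>ker e\<close> to have dimension at most \<open>r\<close>.  An idempotent differs from \<open>2 I\<close> by an
  invertible matrix, so a word for \<open>2 I + E\<close> with \<open>E\<close> of rank one has length \<open>m\<close> with \<open>2^(m-1) \<ge> n\<close>.

  \<^emph>\<open>Upper bound.\<close>  Let \<open>k\<close> be maximal such that there are \<open>v\<^sub>1, \<dots>, v\<^sub>k\<close> for which the \<open>2 k\<close> vectors
  \<open>v\<^sub>i, A v\<^sub>i\<close> are linearly independent, and put \<open>j = n - 2 k\<close>.  If \<open>A\<close> is not scalar then \<open>k \<ge> 1\<close>, and if
  \<open>j \<ge> 2\<close> then maximality makes \<open>A\<close> act as a scalar \<open>t\<close> modulo the span \<open>X\<close> of the \<open>2 k\<close> vectors.  On
  \<open>X\<close> the matrix is similar to a block companion matrix \<open>M(p, q)\<close> with rows \<open>(p, q)\<close> and \<open>(1, 0)\<close>.  One step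
  turns \<open>M(p, q)\<close> into \<open>M(p', 4 q + p\<^sup>2 - p p')\<close> with \<open>p'\<close> free.  This recursion has enough freedom
  to reach in four steps the idempotent \<open>M(1, 0)\<close>, and in two steps a matrix that remains invertible
  after subtraction of \<open>t\<close>.  In the latter situation \<open>X\<close> splits off as a direct summand
  and the scalar part can be regrouped with \<open>X\<close> so that \<open>k\<close> doubles, or else becomes at least
  \<open>(n - 1) / 2\<close>.  So \<open>2 (L - 1)\<close> steps, with \<open>L = \<lceil>log\<^sub>2 n\<rceil>\<close>, lead to \<open>j \<le> 1\<close>.  If \<open>j = 0\<close>, four further
  steps finish.  If \<open>j = 1\<close>, at most seven further steps finish a block triangular matrix
  (\<open>odd_triangular_word_values\<close>), and when \<open>A\<close> has \<open>j = 1\<close> from the start, two steps make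
  it block triangular (\<open>odd_triangularize\<close>).  In all cases the word has length at most \<open>4 + 3 L\<close>
  (\<open>word_values_nonscalar\<close>), and \<open>4 + 3 L \<le> 2 + 5 L\<close> because \<open>L \<ge> 1\<close>.
\<close>

section \<open>Idempotent words of matrices\<close>

lemma two_neq_zero:
  assumes "CHAR('a::field) \<noteq> 2"
  shows "(2::'a) \<noteq> 0"
proof
  assume "(2::'a) = 0"
  then have "of_nat 2 = (0::'a)" by simp
  then have "CHAR('a) dvd 2" by (simp only: of_nat_eq_0_iff_char_dvd)
  moreover have "CHAR('a) \<noteq> 1" by simp
  ultimately show False using assms by (metis prime_nat_iff two_is_prime_nat)
qed

lemma smult_smult_mat: "a \<cdot>\<^sub>m (b \<cdot>\<^sub>m A) = (a * b :: 'a::field) \<cdot>\<^sub>m A"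
  by (rule eq_matI) auto

lemma one_smult_mat [simp]: "(1::'a::field) \<cdot>\<^sub>m A = A"
  by (rule eq_matI) auto

lemma jordan_product_carrier [simp, intro]:
  assumes "X \<in> carrier_mat n n" "Y \<in> carrier_mat n n"
  shows "jordan_product X Y \<in> carrier_mat n n"
  using assms by (auto simp: jordan_product_def)

lemma jordan_product_self:
  assumes "(2::'a::field) \<noteq> 0" "X \<in> carrier_mat n n"
  shows "jordan_product X X = (X * X :: 'a mat)"
proof -
  have "X * X + X * X = 2 \<cdot>\<^sub>m (X * X)" using assms by (intro eq_matI) auto
  then show ?thesis using assms by (simp add: jordan_product_def smult_smult_mat)
qed

lemma idempotents_mat:
  assumes "(2::'a::field) \<noteq> 0"
  shows "idempotents (carrier_mat n n) jordan_product = {e :: 'a mat. e \<in> carrier_mat n n \<and> e * e = e}"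
  using jordan_product_self[OF assms] by (auto simp: idempotents_def)

lemma jordan_product_conj:
  fixes P Q X Y :: "'a::field mat"
  assumes PQ: "P \<in> carrier_mat n n" "Q \<in> carrier_mat n n" "Q * P = 1\<^sub>m n"
    and X: "X \<in> carrier_mat n n" and Y: "Y \<in> carrier_mat n n"
  shows "P * jordan_product X Y * Q = jordan_product (P * X * Q) (P * Y * Q)"
proof -
  note [simp] = assoc_mult_mat[of _ n n _ n _ n]
  have conj: "(P * A * Q) * (P * B * Q) = P * (A * B) * Q"
    if "A \<in> carrier_mat n n" "B \<in> carrier_mat n n" for A B
  proof -
    have "(P * A * Q) * (P * B * Q) = P * A * ((Q * P) * B * Q)" using that PQ(1,2) by simp
    also have "\<dots> = P * (A * B) * Q" unfolding PQ(3) using that PQ(1,2) by simp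
    finally show ?thesis .
  qed
  have "P * jordan_product X Y * Q = (1/2) \<cdot>\<^sub>m (P * (X * Y + Y * X) * Q)"
    unfolding jordan_product_def using PQ(1,2) X Y
    by (simp add: mult_smult_distrib[of _ n n _ n] mult_smult_assoc_mat[of _ n n _ n])
  also have "P * (X * Y + Y * X) * Q = P * (X * Y) * Q + P * (Y * X) * Q"
    using PQ(1,2) X Y
    by (simp add: mult_add_distrib_mat[of _ n n _ n] add_mult_distrib_mat[of _ n n _ _ n])
  also have "\<dots> = (P * X * Q) * (P * Y * Q) + (P * Y * Q) * (P * X * Q)"
    using conj[OF X Y] conj[OF Y X] by simp
  finally show ?thesis by (simp add: jordan_product_def)
qed

lemma idempotent_conj:
  fixes e :: "'a::field mat"
  assumes two: "(2::'a) \<noteq> 0"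
    and PQ: "P \<in> carrier_mat n n" "Q \<in> carrier_mat n n" "Q * P = 1\<^sub>m n"
    and e: "e \<in> idempotents (carrier_mat n n) jordan_product"
  shows "P * e * Q \<in> idempotents (carrier_mat n n) jordan_product"
  using jordan_product_conj[OF PQ, of e e] e PQ(1,2) by (auto simp: idempotents_def)

definition word_values :: "nat \<Rightarrow> nat \<Rightarrow> 'a::field mat set" where
  "word_values n m = {word_value jordan_product es | es.
     es \<in> idempotent_words (carrier_mat n n) jordan_product \<and> length es = m}"

lemma word_values_1:
  "e \<in> idempotents (carrier_mat n n) jordan_product \<Longrightarrow> e \<in> word_values n 1"
  unfolding word_values_def idempotent_words_def
  by (rule CollectI, rule exI[of _ "[e]"]) (auto simp: word_value_def)

lemma word_value_snoc: "es \<noteq> [] \<Longrightarrow> word_value p (es @ [e]) = p (word_value p es) e"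
  by (cases es) (auto simp: word_value_def)

lemma word_values_Suc:
  assumes "C \<in> word_values n m" "e \<in> idempotents (carrier_mat n n) jordan_product"
  shows "jordan_product C e \<in> word_values n (Suc m)"
proof -
  from assms(1) obtain es where es: "es \<in> idempotent_words (carrier_mat n n) jordan_product"
    "length es = m" "C = word_value jordan_product es" unfolding word_values_def by auto
  show ?thesis unfolding word_values_def
    by (rule CollectI, rule exI[of _ "es @ [e]"])
      (use es assms(2) in \<open>auto simp: idempotent_words_def word_value_snoc\<close>)
qed

lemma word_values_induct [consumes 1, case_names idem Suc]:
  assumes "A \<in> word_values n m"
    and "\<And>e. e \<in> idempotents (carrier_mat n n) jordan_product \<Longrightarrow> Q 1 e"
    and "\<And>m C e. C \<in> word_values n m \<Longrightarrow> Q m C \<Longrightarrow> e \<in> idempotents (carrier_mat n n) jordan_product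
      \<Longrightarrow> Q (Suc m) (jordan_product C e)"
  shows "Q m A"
proof -
  from assms(1) obtain es where es: "es \<in> idempotent_words (carrier_mat n n) jordan_product"
    "length es = m" "A = word_value jordan_product es" unfolding word_values_def by auto
  have "Q (length es) (word_value jordan_product es)" using es(1)
  proof (induction es rule: rev_induct)
    case Nil
    then show ?case by (simp add: idempotent_words_def)
  next
    case (snoc e es)
    have e: "e \<in> idempotents (carrier_mat n n) jordan_product"
      using snoc.prems by (auto simp: idempotent_words_def)
    show ?case
    proof (cases "es = []")
      case True
      then show ?thesis using assms(2)[OF e] by (simp add: word_value_def)
    next
      case False
      then have "es \<in> idempotent_words (carrier_mat n n) jordan_product"
        using snoc.prems by (auto simp: idempotent_words_def)
      then have "word_value jordan_product es \<in> word_values n (length es)"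
        "Q (length es) (word_value jordan_product es)"
        using snoc.IH unfolding word_values_def by auto
      from assms(3)[OF this e] show ?thesis using False by (simp add: word_value_snoc)
    qed
  qed
  then show ?thesis using es by simp
qed

lemma word_values_carrier: "A \<in> word_values n m \<Longrightarrow> A \<in> carrier_mat n n"
  by (induction rule: word_values_induct) (auto simp: idempotents_def)

lemma word_values_similar:
  fixes A :: "'a::field mat"
  assumes two: "(2::'a) \<noteq> 0" and "B \<in> word_values n m" "similar_mat A B"
  shows "A \<in> word_values n m"
proof -
  from assms(3) obtain P Q where w: "similar_mat_wit A B P Q" unfolding similar_mat_def by auto
  from word_values_carrier[OF assms(2)] similar_mat_witD[OF refl w]
  have PQ: "P \<in> carrier_mat n n" "Q \<in> carrier_mat n n" "Q * P = 1\<^sub>m n" and A: "A = P * B * Q"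
    by (metis carrier_matD(1))+
  have "P * B * Q \<in> word_values n m" using assms(2)
  proof (induction rule: word_values_induct)
    case (idem e)
    show ?case by (rule word_values_1[OF idempotent_conj[OF two PQ idem]])
  next
    case (Suc m C e)
    then have "e \<in> carrier_mat n n" by (auto simp: idempotents_def)
    from jordan_product_conj[OF PQ word_values_carrier[OF Suc.hyps(1)] this]
      word_values_Suc[OF Suc.IH idempotent_conj[OF two PQ Suc.hyps(2)]]
    show ?case by simp
  qed
  then show ?thesis by (simp add: A)
qed

text \<open>
  Reading words backwards: \<open>A\<close> is obtained from \<open>B\<close> by \<open>m\<close> multiplications by idempotents.  A change
  of basis is allowed before each of them and at the end, since conjugation maps words to words;
  every step can therefore use the basis in which its idempotent is diagonal.
\<close>

inductive reduces :: "nat \<Rightarrow> nat \<Rightarrow> 'a::field mat \<Rightarrow> 'a mat \<Rightarrow> bool" for n where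
  similar: "A \<in> carrier_mat n n \<Longrightarrow> similar_mat A B \<Longrightarrow> reduces n 0 A B"
| step: "e \<in> carrier_mat n n \<Longrightarrow> e * e = e \<Longrightarrow> C \<in> carrier_mat n n \<Longrightarrow>
    similar_mat A (jordan_product C e) \<Longrightarrow> reduces n m C B \<Longrightarrow> reduces n (Suc m) A B"

lemma similar_mat_carrier:
  "similar_mat A B \<Longrightarrow> B \<in> carrier_mat n n \<Longrightarrow> A \<in> carrier_mat n n"
  "similar_mat A B \<Longrightarrow> A \<in> carrier_mat n n \<Longrightarrow> B \<in> carrier_mat n n"
  by (auto dest!: similar_matD)

lemma reduces_similar:
  "similar_mat A B \<Longrightarrow> reduces n m B C \<Longrightarrow> reduces n m A C"
  by (erule reduces.cases) (auto intro: reduces.intros similar_mat_trans similar_mat_carrier)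

lemma reduces_trans:
  "reduces n m A B \<Longrightarrow> reduces n l B C \<Longrightarrow> reduces n (m + l) A C"
  by (induction rule: reduces.induct) (auto intro: reduces_similar reduces.intros)

lemma reduces_similar_right: "reduces n m A B \<Longrightarrow> similar_mat B C \<Longrightarrow> reduces n m A C"
  by (induction rule: reduces.induct) (auto intro: reduces.intros similar_mat_trans)

lemma reduces_carrier:
  "reduces n m A B \<Longrightarrow> A \<in> carrier_mat n n" "reduces n m A B \<Longrightarrow> B \<in> carrier_mat n n"
  by (induction rule: reduces.induct)
    (auto intro: similar_mat_carrier jordan_product_carrier)

lemma reduces_word_values:
  fixes A :: "'a::field mat"
  assumes "(2::'a) \<noteq> 0" "reduces n m A B" "B \<in> word_values n l"
  shows "A \<in> word_values n (l + m)"
  using assms(2,3)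
proof (induction rule: reduces.induct)
  case (similar A B)
  then show ?case using word_values_similar[OF assms(1)] by auto
next
  case (step e C A m B)
  then have "jordan_product C e \<in> word_values n (Suc (l + m))"
    using idempotents_mat[OF assms(1)] by (intro word_values_Suc) auto
  then show ?case using word_values_similar[OF assms(1)] step by auto
qed

lemma jordan_product_one:
  assumes "(2::'a::field) \<noteq> 0" "X \<in> carrier_mat n n"
  shows "jordan_product X (1\<^sub>m n) = (X :: 'a mat)"
proof -
  have "X + X = 2 \<cdot>\<^sub>m X" using assms by (intro eq_matI) auto
  then show ?thesis using assms by (simp add: jordan_product_def smult_smult_mat)
qed

text \<open>Multiplying by the identity lengthens a word without changing its value.\<close>

lemma word_values_mono:
  assumes "(2::'a::field) \<noteq> 0" "l \<le> m"
  shows "word_values n l \<subseteq> (word_values n m :: 'a mat set)"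
  using assms(2)
proof (induction rule: dec_induct)
  case (step k)
  have "X \<in> word_values n (Suc k)" if "X \<in> word_values n k" for X :: "'a mat"
    using word_values_Suc[OF that, of "1\<^sub>m n"] jordan_product_one[OF assms(1) word_values_carrier[OF that]]
    by (simp add: idempotents_mat[OF assms(1)])
  then show ?case using step by auto
qed auto

text \<open>
  Multiplication by \<open>e \<oplus> 1\<close> acts on the off-diagonal blocks as multiplication by \<open>(1 + e) / 2\<close>,
  whose inverse is \<open>2 - e\<close>.
\<close>

lemma jordan_product_four_block:
  fixes C e H K S :: "'a::field mat"
  assumes two: "(2::'a) \<noteq> 0"
    and C: "C \<in> carrier_mat n n" and e: "e \<in> carrier_mat n n" "e * e = e"
    and H: "H \<in> carrier_mat n j" and K: "K \<in> carrier_mat j n" and S: "S \<in> carrier_mat j j"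
  shows "jordan_product (four_block_mat C ((2 \<cdot>\<^sub>m 1\<^sub>m n - e) * H) (K * (2 \<cdot>\<^sub>m 1\<^sub>m n - e)) S)
      (four_block_mat e (0\<^sub>m n j) (0\<^sub>m j n) (1\<^sub>m j)) = four_block_mat (jordan_product C e) H K S"
proof -
  let ?E = "four_block_mat e (0\<^sub>m n j) (0\<^sub>m j n) (1\<^sub>m j)"
  let ?w = "2 \<cdot>\<^sub>m 1\<^sub>m n - e"
  let ?B = "four_block_mat C (?w * H) (K * ?w) S"
  have w: "?w \<in> carrier_mat n n" using e by auto
  have we: "e * ?w = e" "?w * e = e"
    by (rule eq_matI, use e in \<open>auto simp: mult_minus_distrib_mat[of _ n n _ n] minus_mult_distrib_mat[of _ n n _ _ n] mult_smult_distrib[of _ n n _ n] mult_smult_assoc_mat[of _ n n _ n] simp del: index_mult_mat(1)\<close>)+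
  have 1: "?B * ?E = four_block_mat (C * e) (?w * H) (K * e) S"
    by (subst mult_four_block_mat[OF C _ _ S e(1) _ _ one_carrier_mat])
      (use C e H K S w we in \<open>auto simp: assoc_mult_mat[of _ j n _ n _ n]\<close>)
  have 2: "?E * ?B = four_block_mat (e * C) (e * H) (K * ?w) S"
    by (subst mult_four_block_mat[OF e(1) _ _ one_carrier_mat C _ _ S])
      (use C e H K S w we in \<open>auto simp: assoc_mult_mat[of _ n n _ n _ j, symmetric]\<close>)
  have 3: "?w * H + e * H = 2 \<cdot>\<^sub>m H" "K * e + K * ?w = 2 \<cdot>\<^sub>m K" "S + S = 2 \<cdot>\<^sub>m S"
    by (rule eq_matI, use e H K S in \<open>auto simp: mult_minus_distrib_mat[of _ j n _ n] minus_mult_distrib_mat[of _ n n _ _ j] mult_smult_distrib[of _ j n _ n] mult_smult_assoc_mat[of _ n n _ j] simp del: index_mult_mat(1)\<close>)+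
  have "?B * ?E + ?E * ?B = four_block_mat (C * e + e * C) (2 \<cdot>\<^sub>m H) (2 \<cdot>\<^sub>m K) (2 \<cdot>\<^sub>m S)"
    unfolding 1 2 by (subst add_four_block_mat[of _ n n _ j _ j]) (use C e H K S w 3 in auto)
  then show ?thesis unfolding jordan_product_def
    using two C e H K S by (simp add: smult_four_block_mat[of _ n n _ j _ j] smult_smult_mat)
qed

lemma idempotent_four_block:
  fixes e f :: "'a::field mat"
  assumes "e \<in> carrier_mat n n" "e * e = e" "f \<in> carrier_mat j j" "f * f = f"
  shows "four_block_mat e (0\<^sub>m n j) (0\<^sub>m j n) f * four_block_mat e (0\<^sub>m n j) (0\<^sub>m j n) f
    = four_block_mat e (0\<^sub>m n j) (0\<^sub>m j n) f"
  by (subst mult_four_block_mat[of _ n n _ j _ j _ _ n _ j]) (use assms in auto)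

text \<open>
  A reduction of a diagonal block extends to the whole matrix: replace each idempotent \<open>e\<close> by
  \<open>e \<oplus> 1\<close>.  The off-diagonal blocks are multiplied by matrices \<open>Z\<close> and \<open>Z'\<close> that depend only on the reduction
  of \<open>G\<close>, so an off-diagonal block that vanishes stays zero.
\<close>

lemma reduces_four_block:
  fixes G :: "'a::field mat"
  assumes two: "(2::'a) \<noteq> 0"
    and "reduces n m G G'" and S: "S \<in> carrier_mat j j"
  shows "\<exists>Z Z'. Z \<in> carrier_mat n n \<and> Z' \<in> carrier_mat n n \<and>
    (\<forall>H K. H \<in> carrier_mat n j \<longrightarrow> K \<in> carrier_mat j n \<longrightarrow>
      reduces (n + j) m (four_block_mat G H K S) (four_block_mat G' (Z * H) (K * Z') S))"
  using assms(2)
proof (induction rule: reduces.induct)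
  case (similar A B)
  then obtain P Q where w: "similar_mat_wit A B P Q" unfolding similar_mat_def by auto
  note wD = similar_mat_witD2(1,2,4-)[OF similar(1) w]
  have "reduces (n + j) 0 (four_block_mat A H K S) (four_block_mat B (Q * H) (K * P) S)"
    if H: "H \<in> carrier_mat n j" and K: "K \<in> carrier_mat j n" for H K
  proof -
    have "similar_mat_wit (four_block_mat A H K S) (four_block_mat B (Q * H) (K * P) S)
      (four_block_mat P (0\<^sub>m n j) (0\<^sub>m j n) (1\<^sub>m j)) (four_block_mat Q (0\<^sub>m n j) (0\<^sub>m j n) (1\<^sub>m j))"
    proof (rule similar_mat_wit_four_block[OF w similar_mat_wit_refl[OF S]])
      show "H = P * (Q * H) * 1\<^sub>m j"
        using wD H by (simp add: assoc_mult_mat[of P n n Q n H j, symmetric])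
      show "K = 1\<^sub>m j * (K * P) * Q"
        using wD K by (simp add: assoc_mult_mat[of K j n P n Q n])
    qed (use wD S H K in auto)
    then have "similar_mat (four_block_mat A H K S) (four_block_mat B (Q * H) (K * P) S)"
      unfolding similar_mat_def by blast
    then show ?thesis using similar(1) S by (intro reduces.similar) auto
  qed
  then show ?case using wD by blast
next
  case (step e C A m B)
  have Jc: "jordan_product C e \<in> carrier_mat n n" using step by auto
  then have A: "A \<in> carrier_mat n n" using step similar_mat_carrier by blast
  from step obtain P Q where w: "similar_mat_wit A (jordan_product C e) P Q"
    unfolding similar_mat_def by auto
  note wD = similar_mat_witD2(1,2,6,7)[OF A w]
  obtain Z Z' where Z: "Z \<in> carrier_mat n n" "Z' \<in> carrier_mat n n"
    and red: "\<And>H K. H \<in> carrier_mat n j \<Longrightarrow> K \<in> carrier_mat j n \<Longrightarrow>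
      reduces (n + j) m (four_block_mat C H K S) (four_block_mat B (Z * H) (K * Z') S)"
    using step.IH by blast
  let ?w = "2 \<cdot>\<^sub>m 1\<^sub>m n - e"
  have wc: "?w \<in> carrier_mat n n" using step by auto
  have "reduces (n + j) (Suc m) (four_block_mat A H K S)
    (four_block_mat B ((Z * ?w * Q) * H) (K * (P * ?w * Z')) S)"
    if H: "H \<in> carrier_mat n j" and K: "K \<in> carrier_mat j n" for H K
  proof -
    have "similar_mat_wit (four_block_mat A H K S)
      (four_block_mat (jordan_product C e) (Q * H) (K * P) S)
      (four_block_mat P (0\<^sub>m n j) (0\<^sub>m j n) (1\<^sub>m j)) (four_block_mat Q (0\<^sub>m n j) (0\<^sub>m j n) (1\<^sub>m j))"
    proof (rule similar_mat_wit_four_block[OF w similar_mat_wit_refl[OF S]])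
      show "H = P * (Q * H) * 1\<^sub>m j"
        using wD H by (simp add: assoc_mult_mat[of P n n Q n H j, symmetric])
      show "K = 1\<^sub>m j * (K * P) * Q"
        using wD K by (simp add: assoc_mult_mat[of K j n P n Q n])
    qed (use wD A S H K in auto)
    then have sim: "similar_mat (four_block_mat A H K S)
      (jordan_product (four_block_mat C (?w * (Q * H)) ((K * P) * ?w) S)
        (four_block_mat e (0\<^sub>m n j) (0\<^sub>m j n) (1\<^sub>m j)))"
      using jordan_product_four_block[OF two step(3,1,2), of "Q * H" j "K * P" S] S H K wD
      unfolding similar_mat_def by auto
    have "reduces (n + j) m (four_block_mat C (?w * (Q * H)) ((K * P) * ?w) S)
      (four_block_mat B (Z * (?w * (Q * H))) ((K * P) * ?w * Z') S)"
      by (rule red) (use wc wD H K in auto)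
    moreover have "Z * (?w * (Q * H)) = (Z * ?w * Q) * H" "(K * P) * ?w * Z' = K * (P * ?w * Z')"
      using wc wD H K Z
      by (auto simp: assoc_mult_mat[of _ n n _ n _ j] assoc_mult_mat[of _ n n _ n _ n]
        assoc_mult_mat[of _ j n _ n _ n])
    ultimately have red': "reduces (n + j) m (four_block_mat C (?w * (Q * H)) ((K * P) * ?w) S)
      (four_block_mat B ((Z * ?w * Q) * H) (K * (P * ?w * Z')) S)" by simp
    show ?thesis
      by (rule reduces.step[OF _ _ _ sim red'])
        (use step S idempotent_four_block[OF step(1,2), of "1\<^sub>m j" j] in auto)
  qed
  moreover have "Z * ?w * Q \<in> carrier_mat n n" "P * ?w * Z' \<in> carrier_mat n n"
    using wD wc Z by (meson mult_carrier_mat)+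
  ultimately show ?case by blast
qed

corollary reduces_upper_triangular:
  fixes G :: "'a::field mat"
  assumes "(2::'a) \<noteq> 0" "reduces n m G G'" "S \<in> carrier_mat j j" "H \<in> carrier_mat n j"
  obtains H' where "H' \<in> carrier_mat n j"
    "reduces (n + j) m (four_block_mat G H (0\<^sub>m j n) S) (four_block_mat G' H' (0\<^sub>m j n) S)"
proof -
  obtain Z Z' where Z: "Z \<in> carrier_mat n n" "Z' \<in> carrier_mat n n" and
    *: "\<forall>H K. H \<in> carrier_mat n j \<longrightarrow> K \<in> carrier_mat j n \<longrightarrow>
      reduces (n + j) m (four_block_mat G H K S) (four_block_mat G' (Z * H) (K * Z') S)"
    using reduces_four_block[OF assms(1-3)] by blast
  then show ?thesis using that[of "Z * H"] *[rule_format, OF assms(4) zero_carrier_mat] assms(4) by auto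
qed

corollary reduces_direct_sum:
  fixes G :: "'a::field mat"
  assumes "(2::'a) \<noteq> 0" "reduces n m G G'" "S \<in> carrier_mat j j"
  shows "reduces (n + j) m (four_block_mat G (0\<^sub>m n j) (0\<^sub>m j n) S) (four_block_mat G' (0\<^sub>m n j) (0\<^sub>m j n) S)"
proof -
  obtain Z Z' where Z: "Z \<in> carrier_mat n n" "Z' \<in> carrier_mat n n" and
    *: "\<forall>H K. H \<in> carrier_mat n j \<longrightarrow> K \<in> carrier_mat j n \<longrightarrow>
      reduces (n + j) m (four_block_mat G H K S) (four_block_mat G' (Z * H) (K * Z') S)"
    using reduces_four_block[OF assms(1-3)] by blast
  then show ?thesis using *[rule_format, OF zero_carrier_mat zero_carrier_mat] by auto
qed

declare minus_carrier_mat [simp]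

lemma uminus_zero_mat [simp]: "- 0\<^sub>m m n = (0\<^sub>m m n :: 'a::group_add mat)"
  by (rule eq_matI) auto

section \<open>Block companion matrices\<close>

text \<open>
  The block analogue of the companion matrix of a quadratic polynomial: \<open>M\<^sup>2 = p M + q\<close>, where \<open>p\<close> and
  \<open>q\<close> act on both coordinate blocks.  Its zero corner is what makes it a product with an idempotent.
\<close>

definition companion_block :: "nat \<Rightarrow> 'a::field mat \<Rightarrow> 'a mat \<Rightarrow> 'a mat" where
  "companion_block k p q = four_block_mat p q (1\<^sub>m k) (0\<^sub>m k k)"

lemma companion_block_carrier [simp]:
  "p \<in> carrier_mat k k \<Longrightarrow> q \<in> carrier_mat k k \<Longrightarrow> companion_block k p q \<in> carrier_mat (k + k) (k + k)"
  unfolding companion_block_def by (rule four_block_carrier_mat) auto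

text \<open>
  Each matrix whose lower left block \<open>g\<close> is invertible has companion form: in the new basis the second
  coordinate block \<open>y\<close> is kept and the first one becomes \<open>g x + d y\<close>, the second component of the image.
  The conjugating matrices are block triangular, which is needed when further rows are attached.
\<close>

lemma similar_wit_companion_block:
  fixes a :: "'a::field mat"
  assumes a: "a \<in> carrier_mat k k" and b: "b \<in> carrier_mat k k" and g: "g \<in> carrier_mat k k"
    and d: "d \<in> carrier_mat k k" and g': "g' \<in> carrier_mat k k" and gg: "g * g' = 1\<^sub>m k"
  defines "p \<equiv> g * a * g' + d"
  defines "q \<equiv> g * b + d * d - p * d"
  shows "similar_mat_wit (four_block_mat a b g d) (companion_block k p q)
    (four_block_mat g' (- (g' * d)) (0\<^sub>m k k) (1\<^sub>m k)) (four_block_mat g d (0\<^sub>m k k) (1\<^sub>m k))"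
    (is "similar_mat_wit ?B ?M ?Q ?P")
proof -
  note [simp] = assoc_mult_mat[of _ k k _ k _ k]
  have g'g: "g' * g = 1\<^sub>m k" by (rule mat_mult_left_right_inverse[OF g g' gg])
  have p: "p \<in> carrier_mat k k" and q: "q \<in> carrier_mat k k" using assms by auto
  have z: "0\<^sub>m k k \<in> carrier_mat k k" and i: "1\<^sub>m k \<in> carrier_mat k k" by auto
  have gd: "- (g' * d) \<in> carrier_mat k k" using g' d by auto
  have PQ: "?P * ?Q = 1\<^sub>m (k + k)"
  proof -
    have "g * - (g' * d) = - d"
      using gg g g' d by (simp add: assoc_mult_mat[of _ k k _ k _ k, symmetric])
    then show ?thesis
      by (subst mult_four_block_mat[OF g d z i g' gd z i]) (use gg d g g' in \<open>simp add: uminus_l_inv_mat[of _ k k]\<close>)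
  qed
  have QP: "?Q * ?P = 1\<^sub>m (k + k)"
    by (subst mult_four_block_mat[OF g' gd z i g d z i]) (use g'g d g g' in \<open>auto intro!: eq_matI simp del: index_mult_mat(1)\<close>)
  have pg: "p * g = g * a + d * g"
    unfolding p_def using a d g g' g'g by (simp add: add_mult_distrib_mat[of _ k k _ _ k])
  have "?P * ?B = four_block_mat (g * a + d * g) (g * b + d * d) g d"
    by (subst mult_four_block_mat[OF g d z i a b g d]) (use a b g d in auto)
  moreover have "?M * ?P = four_block_mat (g * a + d * g) (g * b + d * d) g d"
  proof -
    have "p * d + q = g * b + d * d"
      unfolding q_def by (rule eq_matI) (use p b g d in \<open>auto simp del: index_mult_mat(1)\<close>)
    then show ?thesis unfolding companion_block_def
      by (subst mult_four_block_mat[OF p q i z g d z i]) (use pg p q g d in auto)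
  qed
  ultimately have eq: "?P * ?B = ?M * ?P" by simp
  have cB: "?B \<in> carrier_mat (k + k) (k + k)" and cM: "?M \<in> carrier_mat (k + k) (k + k)"
    and cP: "?P \<in> carrier_mat (k + k) (k + k)" and cQ: "?Q \<in> carrier_mat (k + k) (k + k)"
    using a d p q g g' by auto
  have "?B = (?Q * ?P) * ?B" unfolding QP using left_mult_one_mat[OF cB] by simp
  also have "\<dots> = ?Q * (?P * ?B)" by (rule assoc_mult_mat[OF cQ cP cB])
  also have "\<dots> = ?Q * ?M * ?P" unfolding eq using assoc_mult_mat[OF cQ cM cP] by simp
  finally show ?thesis using PQ QP cB cM cP cQ by (intro similar_mat_witI) auto
qed

lemma similar_companion_block:
  fixes a :: "'a::field mat"
  assumes "a \<in> carrier_mat k k" "b \<in> carrier_mat k k" "g \<in> carrier_mat k k"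
    and "d \<in> carrier_mat k k" "g' \<in> carrier_mat k k" "g * g' = 1\<^sub>m k"
  shows "similar_mat (four_block_mat a b g d)
    (companion_block k (g * a * g' + d) (g * b + d * d - (g * a * g' + d) * d))"
  using similar_wit_companion_block[OF assms] unfolding similar_mat_def by blast

lemma companion_block_jordan_product:
  fixes p :: "'a::field mat"
  assumes two: "(2::'a) \<noteq> 0" and p: "p \<in> carrier_mat k k" and q: "q \<in> carrier_mat k k" and s: "s \<in> carrier_mat k k"
  shows "jordan_product (four_block_mat p (2 \<cdot>\<^sub>m q) (2 \<cdot>\<^sub>m 1\<^sub>m k) s)
      (four_block_mat (1\<^sub>m k) (0\<^sub>m k k) (0\<^sub>m k k) (0\<^sub>m k k)) = companion_block k p q"
    (is "jordan_product ?B ?E = _")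
proof -
  have z: "0\<^sub>m k k \<in> carrier_mat k k" and i: "1\<^sub>m k \<in> carrier_mat k k" by auto
  have q2: "2 \<cdot>\<^sub>m q \<in> carrier_mat k k" and i2: "2 \<cdot>\<^sub>m 1\<^sub>m k \<in> carrier_mat k k" using q by auto
  have "?B * ?E = four_block_mat p (0\<^sub>m k k) (2 \<cdot>\<^sub>m 1\<^sub>m k) (0\<^sub>m k k)"
    by (subst mult_four_block_mat[OF p q2 i2 s i z z z]) (use p q s in auto)
  moreover have "?E * ?B = four_block_mat p (2 \<cdot>\<^sub>m q) (0\<^sub>m k k) (0\<^sub>m k k)"
    by (subst mult_four_block_mat[OF i z z z p q2 i2 s]) (use p q s in auto)
  moreover have "p + p = 2 \<cdot>\<^sub>m p" using p by (intro eq_matI) auto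
  ultimately have "?B * ?E + ?E * ?B = four_block_mat (2 \<cdot>\<^sub>m p) (2 \<cdot>\<^sub>m q) (2 \<cdot>\<^sub>m 1\<^sub>m k) (0\<^sub>m k k)"
    using p q by (simp add: add_four_block_mat[of _ k k _ k _ k])
  then show ?thesis unfolding jordan_product_def companion_block_def
    using two p q by (simp add: smult_four_block_mat[of _ k k _ k _ k] smult_smult_mat)
qed

lemma companion_block_corner_idempotent:
  "four_block_mat (1\<^sub>m k) (0\<^sub>m k k) (0\<^sub>m k k) (0\<^sub>m k k) * four_block_mat (1\<^sub>m k) (0\<^sub>m k k) (0\<^sub>m k k) (0\<^sub>m k k)
    = (four_block_mat (1\<^sub>m k) (0\<^sub>m k k) (0\<^sub>m k k) (0\<^sub>m k k) :: 'a::field mat)"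
  using idempotent_four_block[of "1\<^sub>m k" k "0\<^sub>m k k" k] by simp

lemma companion_block_step_wit:
  fixes p :: "'a::field mat"
  assumes two: "(2::'a) \<noteq> 0" and p: "p \<in> carrier_mat k k" and q: "q \<in> carrier_mat k k" and p': "p' \<in> carrier_mat k k"
  defines "s \<equiv> p' - p"
  shows "similar_mat_wit (four_block_mat p (2 \<cdot>\<^sub>m q) (2 \<cdot>\<^sub>m 1\<^sub>m k) s)
      (companion_block k p' (4 \<cdot>\<^sub>m q + p * p - p * p'))
      (four_block_mat ((1/2) \<cdot>\<^sub>m 1\<^sub>m k) (- ((1/2) \<cdot>\<^sub>m s)) (0\<^sub>m k k) (1\<^sub>m k))
      (four_block_mat (2 \<cdot>\<^sub>m 1\<^sub>m k) s (0\<^sub>m k k) (1\<^sub>m k))"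
proof -
  have s: "s \<in> carrier_mat k k" using p p' by (simp add: s_def)
  let ?g = "2 \<cdot>\<^sub>m 1\<^sub>m k :: 'a mat" and ?g' = "(1/2) \<cdot>\<^sub>m 1\<^sub>m k :: 'a mat"
  have gg: "?g * ?g' = 1\<^sub>m k"
    using two by (simp add: mult_smult_distrib[of _ k k _ k] mult_smult_assoc_mat[of _ k k _ k] smult_smult_mat)
  have 1: "?g * p * ?g' + s = p'" unfolding s_def using two p p'
    by (auto simp: mult_smult_distrib[of _ k k _ k] mult_smult_assoc_mat[of _ k k _ k] smult_smult_mat intro!: eq_matI)
  have 2: "?g * (2 \<cdot>\<^sub>m q) + s * s - p' * s = 4 \<cdot>\<^sub>m q + p * p - p * p'"
    unfolding s_def
    by (rule eq_matI) (use p q p' in \<open>auto simp: mult_smult_distrib[of _ k k _ k] mult_smult_assoc_mat[of _ k k _ k] smult_smult_mat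
      mult_minus_distrib_mat[of _ k k _ k] minus_mult_distrib_mat[of _ k k _ _ k] simp del: index_mult_mat(1)\<close>)
  have 3: "?g' * s = (1/2) \<cdot>\<^sub>m s" using s by (simp add: mult_smult_assoc_mat[of _ k k _ k])
  show ?thesis
    using similar_wit_companion_block[OF p _ _ s _ gg, of "2 \<cdot>\<^sub>m q"] q unfolding 1 2 3 by simp
qed

text \<open>
  One step: the corner \<open>s\<close> of the factor is free, and after the return to companion form it becomes
  the freedom \<open>p' = p + s\<close>.
\<close>

lemma companion_block_step:
  fixes p :: "'a::field mat"
  assumes two: "(2::'a) \<noteq> 0" and p: "p \<in> carrier_mat k k" and q: "q \<in> carrier_mat k k" and p': "p' \<in> carrier_mat k k"
  shows "reduces (k + k) 1 (companion_block k p q) (companion_block k p' (4 \<cdot>\<^sub>m q + p * p - p * p'))"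
proof -
  let ?B = "four_block_mat p (2 \<cdot>\<^sub>m q) (2 \<cdot>\<^sub>m 1\<^sub>m k) (p' - p)"
  let ?E = "four_block_mat (1\<^sub>m k) (0\<^sub>m k k) (0\<^sub>m k k) (0\<^sub>m k k) :: 'a mat"
  have B: "?B \<in> carrier_mat (k + k) (k + k)" using p p' by (intro four_block_carrier_mat) auto
  have red: "reduces (k + k) 0 ?B (companion_block k p' (4 \<cdot>\<^sub>m q + p * p - p * p'))"
    using companion_block_step_wit[OF two p q p'] B by (intro reduces.similar) (auto simp: similar_mat_def)
  have sim: "similar_mat (companion_block k p q) (jordan_product ?B ?E)"
    using companion_block_jordan_product[OF two p q, of "p' - p"] p q p' similar_mat_refl[OF companion_block_carrier[OF p q]] by simp
  show ?thesis
    using reduces.step[OF _ companion_block_corner_idempotent B sim red] by simp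
qed

text \<open>
  With \<open>p\<^sub>0 = t\<close>, \<open>p\<^sub>3 = 1\<close> and \<open>p\<^sub>2 = 2 p\<^sub>1\<close>, the quadratic terms \<open>4 p\<^sub>1\<^sup>2 - 4 p\<^sub>1 p\<^sub>2 + p\<^sub>2\<^sup>2\<close> of \<open>q\<^sub>3\<close> cancel.
  The condition \<open>q\<^sub>3 = 0\<close> is then linear in \<open>p\<^sub>1\<close>, so no square root has to be extracted: it reads
  \<open>(2 + 16 t) p\<^sub>1 = 16 C\<close> with \<open>C = 4 q + t\<^sup>2\<close>.  All matrices involved are polynomials in \<open>q\<close> and commute.
\<close>

lemma companion_block_scalar_to_idempotent:
  fixes q :: "'a::field mat"
  assumes two: "(2::'a) \<noteq> 0" and q: "q \<in> carrier_mat k k" and t: "1 + 8 * t \<noteq> (0::'a)"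
  shows "reduces (k + k) 3 (companion_block k (t \<cdot>\<^sub>m 1\<^sub>m k) q) (companion_block k (1\<^sub>m k) (0\<^sub>m k k))"
proof -
  define C where "C = 4 \<cdot>\<^sub>m q + (t * t) \<cdot>\<^sub>m 1\<^sub>m k"
  define c where "c = 8 / (1 + 8 * t)"
  have c: "c * (1 + 8 * t) = 8" using t unfolding c_def by (metis nonzero_eq_divide_eq)
  have C: "C \<in> carrier_mat k k" using q by (simp add: C_def)
  note [simp] = mult_smult_distrib[of _ k k _ k] mult_smult_assoc_mat[of _ k k _ k] smult_smult_mat
    mult_minus_distrib_mat[of _ k k _ k] minus_mult_distrib_mat[of _ k k _ _ k]
    mult_add_distrib_mat[of _ k k _ k] add_mult_distrib_mat[of _ k k _ _ k]
  have q1: "4 \<cdot>\<^sub>m q + (t \<cdot>\<^sub>m 1\<^sub>m k) * (t \<cdot>\<^sub>m 1\<^sub>m k) - (t \<cdot>\<^sub>m 1\<^sub>m k) * (c \<cdot>\<^sub>m C) = (1 - t * c) \<cdot>\<^sub>m C"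
    by (rule eq_matI) (use q C in \<open>auto simp: algebra_simps C_def\<close>)
  have r1: "reduces (k + k) 1 (companion_block k (t \<cdot>\<^sub>m 1\<^sub>m k) q) (companion_block k (c \<cdot>\<^sub>m C) ((1 - t * c) \<cdot>\<^sub>m C))"
    using companion_block_step[OF two, of "t \<cdot>\<^sub>m 1\<^sub>m k" k q "c \<cdot>\<^sub>m C"] q C unfolding q1 by simp
  have q2: "4 \<cdot>\<^sub>m ((1 - t * c) \<cdot>\<^sub>m C) + (c \<cdot>\<^sub>m C) * (c \<cdot>\<^sub>m C) - (c \<cdot>\<^sub>m C) * ((2 * c) \<cdot>\<^sub>m C)
      = (4 * (1 - t * c)) \<cdot>\<^sub>m C - (c * c) \<cdot>\<^sub>m (C * C)"
    by (rule eq_matI) (use C in \<open>auto simp: algebra_simps simp del: index_mult_mat(1)\<close>)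
  have r2: "reduces (k + k) 1 (companion_block k (c \<cdot>\<^sub>m C) ((1 - t * c) \<cdot>\<^sub>m C))
    (companion_block k ((2 * c) \<cdot>\<^sub>m C) ((4 * (1 - t * c)) \<cdot>\<^sub>m C - (c * c) \<cdot>\<^sub>m (C * C)))"
    using companion_block_step[OF two, of "c \<cdot>\<^sub>m C" k "(1 - t * c) \<cdot>\<^sub>m C" "(2 * c) \<cdot>\<^sub>m C"] C unfolding q2 by simp
  have q3: "4 \<cdot>\<^sub>m ((4 * (1 - t * c)) \<cdot>\<^sub>m C - (c * c) \<cdot>\<^sub>m (C * C)) + ((2 * c) \<cdot>\<^sub>m C) * ((2 * c) \<cdot>\<^sub>m C) - ((2 * c) \<cdot>\<^sub>m C) * 1\<^sub>m k
      = 0\<^sub>m k k" (is "?L = _")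
  proof (rule eq_matI)
    fix i j assume "i < dim_row (0\<^sub>m k k :: 'a mat)" "j < dim_col (0\<^sub>m k k :: 'a mat)"
    then have ij: "i < k" "j < k" by auto
    have "?L $$ (i, j) = (16 - 2 * (c * (1 + 8 * t))) * C $$ (i, j)"
      using C ij by (simp add: algebra_simps del: index_mult_mat(1))
    then show "?L $$ (i, j) = 0\<^sub>m k k $$ (i, j)" using ij by (simp add: c)
  qed (use C in auto)
  have r3: "reduces (k + k) 1 (companion_block k ((2 * c) \<cdot>\<^sub>m C) ((4 * (1 - t * c)) \<cdot>\<^sub>m C - (c * c) \<cdot>\<^sub>m (C * C)))
    (companion_block k (1\<^sub>m k) (0\<^sub>m k k))"
    using companion_block_step[OF two, of "(2 * c) \<cdot>\<^sub>m C" k "(4 * (1 - t * c)) \<cdot>\<^sub>m C - (c * c) \<cdot>\<^sub>m (C * C)" "1\<^sub>m k"] C unfolding q3 by simp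
  show ?thesis using reduces_trans[OF reduces_trans[OF r1 r2] r3] by (simp add: numeral_3_eq_3)
qed

text \<open>
  One more step makes \<open>p\<close> zero, and a scalar \<open>p\<close> is what the previous lemma asks for.
\<close>

lemma companion_block_to_idempotent:
  fixes p q :: "'a::field mat"
  assumes two: "(2::'a) \<noteq> 0" and p: "p \<in> carrier_mat k k" and q: "q \<in> carrier_mat k k"
  shows "reduces (k + k) 4 (companion_block k p q) (companion_block k (1\<^sub>m k) (0\<^sub>m k k))"
proof -
  have z: "0\<^sub>m k k = (0 :: 'a) \<cdot>\<^sub>m 1\<^sub>m k" by (rule eq_matI) auto
  have "reduces (k + k) 1 (companion_block k p q) (companion_block k (0 \<cdot>\<^sub>m 1\<^sub>m k) (4 \<cdot>\<^sub>m q + p * p - p * (0 \<cdot>\<^sub>m 1\<^sub>m k)))"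
    by (rule companion_block_step[OF two p q]) simp
  moreover have "reduces (k + k) 3 (companion_block k (0 \<cdot>\<^sub>m 1\<^sub>m k) (4 \<cdot>\<^sub>m q + p * p - p * (0 \<cdot>\<^sub>m 1\<^sub>m k)))
    (companion_block k (1\<^sub>m k) (0\<^sub>m k k))"
    by (rule companion_block_scalar_to_idempotent[OF two]) (use p q in auto)
  ultimately show ?thesis using reduces_trans by fastforce
qed

lemma companion_block_idempotent:
  "companion_block k (1\<^sub>m k) (0\<^sub>m k k) * companion_block k (1\<^sub>m k) (0\<^sub>m k k) = (companion_block k (1\<^sub>m k) (0\<^sub>m k k) :: 'a::field mat)"
  unfolding companion_block_def by (subst mult_four_block_mat[of _ k k _ k _ k _ _ k _ k]) auto

text \<open>
  The target minus \<open>t\<close> has the rows \<open>(X, 1)\<close> and \<open>(1, 0)\<close>, hence is invertible for every \<open>X\<close>.  In general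
  \<open>M(p, q) - t\<close> is similar to the matrix with rows \<open>(p - 2 t, q + t (p - t))\<close> and \<open>(1, 0)\<close>.  After two steps with \<open>p\<^sub>1 = t + 1\<close>
  the entry \<open>q\<^sub>2 + t (p\<^sub>2 - t)\<close> equals \<open>4 q\<^sub>1 + (t + 1)\<^sup>2 - t\<^sup>2 - p\<^sub>2\<close>, and \<open>p\<^sub>2\<close> can be chosen to make it \<open>1\<close>.
\<close>

lemma companion_block_regularize:
  fixes p q :: "'a::field mat"
  assumes two: "(2::'a) \<noteq> 0" and p: "p \<in> carrier_mat k k" and q: "q \<in> carrier_mat k k"
  obtains X where "X \<in> carrier_mat k k"
    "reduces (k + k) 2 (companion_block k p q) (four_block_mat (X + t \<cdot>\<^sub>m 1\<^sub>m k) (1\<^sub>m k) (1\<^sub>m k) (t \<cdot>\<^sub>m 1\<^sub>m k))"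
proof -
  note [simp] = mult_smult_distrib[of _ k k _ k] mult_smult_assoc_mat[of _ k k _ k] smult_smult_mat
    mult_minus_distrib_mat[of _ k k _ k] minus_mult_distrib_mat[of _ k k _ _ k]
    mult_add_distrib_mat[of _ k k _ k] add_mult_distrib_mat[of _ k k _ _ k]
  define p1 where "p1 = (t + 1) \<cdot>\<^sub>m (1\<^sub>m k :: 'a mat)"
  define q1 where "q1 = 4 \<cdot>\<^sub>m q + p * p - p * p1"
  define p2 where "p2 = 4 \<cdot>\<^sub>m q1 + (2 * t) \<cdot>\<^sub>m 1\<^sub>m k"
  have c: "p1 \<in> carrier_mat k k" "q1 \<in> carrier_mat k k" "p2 \<in> carrier_mat k k"
    using p q by (auto simp: p1_def q1_def p2_def)
  have r: "reduces (k + k) 2 (companion_block k p q) (companion_block k p2 (4 \<cdot>\<^sub>m q1 + p1 * p1 - p1 * p2))"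
    using reduces_trans[OF companion_block_step[OF two p q c(1)] companion_block_step[OF two c(1) _ c(3)]] c
    by (simp add: q1_def[symmetric] numeral_2_eq_2)
  define X where "X = 4 \<cdot>\<^sub>m q1"
  have X: "X \<in> carrier_mat k k" using c by (simp add: X_def)
  have "similar_mat (four_block_mat (X + t \<cdot>\<^sub>m 1\<^sub>m k) (1\<^sub>m k) (1\<^sub>m k) (t \<cdot>\<^sub>m 1\<^sub>m k))
    (companion_block k p2 (4 \<cdot>\<^sub>m q1 + p1 * p1 - p1 * p2))"
  proof -
    have 1: "1\<^sub>m k * (X + t \<cdot>\<^sub>m 1\<^sub>m k) * 1\<^sub>m k + t \<cdot>\<^sub>m 1\<^sub>m k = p2"
      by (rule eq_matI) (use X c in \<open>auto simp: X_def p2_def\<close>)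
    have 2: "1\<^sub>m k * 1\<^sub>m k + (t \<cdot>\<^sub>m 1\<^sub>m k) * (t \<cdot>\<^sub>m 1\<^sub>m k) - p2 * (t \<cdot>\<^sub>m 1\<^sub>m k) = 4 \<cdot>\<^sub>m q1 + p1 * p1 - p1 * p2"
      unfolding p2_def p1_def by (rule eq_matI) (use X c in \<open>auto simp: algebra_simps\<close>)
    show ?thesis
      using similar_companion_block[of "X + t \<cdot>\<^sub>m 1\<^sub>m k" k "1\<^sub>m k" "1\<^sub>m k" "t \<cdot>\<^sub>m 1\<^sub>m k" "1\<^sub>m k"] X
      unfolding 1 2 by simp
  qed
  from reduces_similar_right[OF r similar_mat_sym[OF this]] X that show ?thesis by blast
qed

section \<open>Permutations, shears and direct sums\<close>

lemma minus_zero_mat [simp]: "A \<in> carrier_mat m n \<Longrightarrow> A - 0\<^sub>m m n = (A :: 'a::group_add mat)"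
  by (rule eq_matI) auto

lemma similar_reindex:
  fixes A :: "'a::field mat"
  assumes A: "A \<in> carrier_mat n n" and f: "bij_betw f {..<n} {..<n}"
  shows "similar_mat A (mat n n (\<lambda>(i, j). A $$ (f i, f j)))" (is "similar_mat _ ?B")
proof -
  have fl: "f i < n" if "i < n" for i using f that by (auto simp: bij_betw_def)
  have inj: "f i = f j \<longleftrightarrow> i = j" if "i < n" "j < n" for i j
    using f that by (auto simp: bij_betw_def inj_on_def)
  define P Q :: "'a mat" where "P = mat n n (\<lambda>(i, j). if i = f j then 1 else 0)"
    and "Q = mat n n (\<lambda>(i, j). if j = f i then 1 else 0)"
  have c: "P \<in> carrier_mat n n" "Q \<in> carrier_mat n n" by (auto simp: P_def Q_def)
  have QX: "Q * X = mat n n (\<lambda>(i, j). X $$ (f i, j))" if "X \<in> carrier_mat n n" for X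
    by (rule eq_matI) (use that fl in \<open>auto simp: Q_def scalar_prod_def if_distrib[of "\<lambda>x. x * _"] cong: if_cong\<close>)
  have XP: "X * P = mat n n (\<lambda>(i, j). X $$ (i, f j))" if "X \<in> carrier_mat n n" for X
    by (rule eq_matI) (use that fl in \<open>auto simp: P_def scalar_prod_def if_distrib[of "\<lambda>x. _ * x"] cong: if_cong\<close>)
  have QP: "Q * P = 1\<^sub>m n" unfolding QX[OF c(1)] by (rule eq_matI) (use fl inj in \<open>auto simp: P_def\<close>)
  have B: "Q * A * P = ?B" unfolding QX[OF A]
    by (subst XP) (use fl in \<open>auto intro!: eq_matI\<close>)
  have "similar_mat_wit ?B A Q P"
    by (rule similar_mat_witI[OF QP mat_mult_left_right_inverse[OF c(2,1) QP]]) (use A B c in auto)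
  then show ?thesis using similar_mat_wit_sym unfolding similar_mat_def by blast
qed

lemma four_block_split:
  assumes "A \<in> carrier_mat (m + l) (m + l)"
  shows "A = four_block_mat (mat m m (\<lambda>(i, j). A $$ (i, j))) (mat m l (\<lambda>(i, j). A $$ (i, m + j)))
    (mat l m (\<lambda>(i, j). A $$ (m + i, j))) (mat l l (\<lambda>(i, j). A $$ (m + i, m + j)))"
  by (rule eq_matI) (use assms in auto)

lemma similar_upper_shear:
  fixes A :: "'a::field mat"
  assumes A: "A \<in> carrier_mat n n" and B: "B \<in> carrier_mat n j" and C: "C \<in> carrier_mat j n"
    and D: "D \<in> carrier_mat j j" and F: "F \<in> carrier_mat n j"
  shows "similar_mat (four_block_mat A B C D)
    (four_block_mat (A + F * C) (B + F * D - (A + F * C) * F) C (D - C * F))"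
    (is "similar_mat ?X ?Y")
proof -
  define P Q :: "'a mat" where "P = four_block_mat (1\<^sub>m n) F (0\<^sub>m j n) (1\<^sub>m j)"
    and "Q = four_block_mat (1\<^sub>m n) (- F) (0\<^sub>m j n) (1\<^sub>m j)"
  have i: "1\<^sub>m n \<in> carrier_mat n n" "1\<^sub>m j \<in> carrier_mat j j" "0\<^sub>m j n \<in> carrier_mat j n" "- F \<in> carrier_mat n j"
    using F by auto
  have c: "P \<in> carrier_mat (n + j) (n + j)" "Q \<in> carrier_mat (n + j) (n + j)" by (auto simp: P_def Q_def)
  have "- F + F = 0\<^sub>m n j" by (rule eq_matI) (use F in auto)
  then have PQ: "P * Q = 1\<^sub>m (n + j)" unfolding P_def Q_def
    by (subst mult_four_block_mat[OF i(1) F i(3,2) i(1) i(4) i(3,2)]) (use F in simp)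
  have 1: "P * ?X = four_block_mat (A + F * C) (B + F * D) C D" unfolding P_def
    by (subst mult_four_block_mat[OF i(1) F i(3,2) A B C D]) (use A B C D F in simp)
  have "(A + F * C) * - F + (B + F * D) = B + F * D - (A + F * C) * F" "C * - F + D = D - C * F"
    by (rule eq_matI, use A B C D F in \<open>auto simp del: index_mult_mat(1)\<close>)+
  then have "P * ?X * Q = ?Y" unfolding 1 unfolding Q_def
    by (subst mult_four_block_mat[of _ n n _ j _ j _ _ n _ j]) (use A B C D F in auto)
  then have "similar_mat_wit ?Y ?X P Q"
    using A B C D F c by (intro similar_mat_witI[OF PQ mat_mult_left_right_inverse[OF c PQ]]) auto
  then show ?thesis using similar_mat_wit_sym unfolding similar_mat_def by blast
qed

lemma similar_lower_shear:
  fixes A :: "'a::field mat"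
  assumes A: "A \<in> carrier_mat n n" and B: "B \<in> carrier_mat n j" and C: "C \<in> carrier_mat j n"
    and D: "D \<in> carrier_mat j j" and F: "F \<in> carrier_mat j n"
  shows "similar_mat (four_block_mat A B C D)
    (four_block_mat (A - B * F) B (F * A + C - (F * B + D) * F) (F * B + D))"
    (is "similar_mat ?X ?Y")
proof -
  define P Q :: "'a mat" where "P = four_block_mat (1\<^sub>m n) (0\<^sub>m n j) F (1\<^sub>m j)"
    and "Q = four_block_mat (1\<^sub>m n) (0\<^sub>m n j) (- F) (1\<^sub>m j)"
  have i: "1\<^sub>m n \<in> carrier_mat n n" "1\<^sub>m j \<in> carrier_mat j j" "0\<^sub>m n j \<in> carrier_mat n j" "- F \<in> carrier_mat j n"
    using F by auto
  have c: "P \<in> carrier_mat (n + j) (n + j)" "Q \<in> carrier_mat (n + j) (n + j)" by (auto simp: P_def Q_def)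
  have "F + - F = 0\<^sub>m j n" by (rule eq_matI) (use F in auto)
  then have PQ: "P * Q = 1\<^sub>m (n + j)" unfolding P_def Q_def
    by (subst mult_four_block_mat[OF i(1,3) F i(2) i(1,3,4,2)]) (use F in simp)
  have 1: "P * ?X = four_block_mat A B (F * A + C) (F * B + D)" unfolding P_def
    by (subst mult_four_block_mat[OF i(1,3) F i(2) A B C D]) (use A B C D F in simp)
  have "A + B * - F = A - B * F" "F * A + C + (F * B + D) * - F = F * A + C - (F * B + D) * F"
    by (rule eq_matI, use A B C D F in \<open>auto simp del: index_mult_mat(1)\<close>)+
  then have "P * ?X * Q = ?Y" unfolding 1 unfolding Q_def
    by (subst mult_four_block_mat[of _ n n _ j _ j _ _ n _ j]) (use A B C D F in auto)
  then have "similar_mat_wit ?Y ?X P Q"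
    using A B C D F c by (intro similar_mat_witI[OF PQ mat_mult_left_right_inverse[OF c PQ]]) auto
  then show ?thesis using similar_mat_wit_sym unfolding similar_mat_def by blast
qed

text \<open>
  A shear by \<open>F\<close> changes the upper right block \<open>H\<close> by \<open>-(G - t) F\<close>.
\<close>

lemma similar_decouple:
  fixes G :: "'a::field mat"
  assumes G: "G \<in> carrier_mat n n" and H: "H \<in> carrier_mat n j" and R': "R' \<in> carrier_mat n n"
    and inv: "(G - t \<cdot>\<^sub>m 1\<^sub>m n) * R' = 1\<^sub>m n"
  shows "similar_mat (four_block_mat G H (0\<^sub>m j n) (t \<cdot>\<^sub>m 1\<^sub>m j)) (four_block_mat G (0\<^sub>m n j) (0\<^sub>m j n) (t \<cdot>\<^sub>m 1\<^sub>m j))"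
proof -
  define F where "F = R' * H"
  have F: "F \<in> carrier_mat n j" using R' H by (simp add: F_def)
  have "(G - t \<cdot>\<^sub>m 1\<^sub>m n) * F = H"
    unfolding F_def using inv G R' H by (simp add: assoc_mult_mat[of _ n n _ n _ j, symmetric])
  then have GF: "G * F - t \<cdot>\<^sub>m F = H"
    using G F by (simp add: minus_mult_distrib_mat[of _ n n _ _ j] mult_smult_assoc_mat[of _ n n _ j])
  have "H + F * (t \<cdot>\<^sub>m 1\<^sub>m j) - G * F = 0\<^sub>m n j"
    unfolding GF[symmetric]
    by (rule eq_matI) (use G F in \<open>auto simp: mult_smult_distrib[of _ n j _ j] simp del: index_mult_mat(1)\<close>)
  then show ?thesis
    using similar_upper_shear[OF G H zero_carrier_mat _ F, of "t \<cdot>\<^sub>m 1\<^sub>m j"] G F by simp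
qed

section \<open>Doubling the companion block\<close>

lemma regularized_inverse:
  fixes X :: "'a::field mat"
  assumes X: "X \<in> carrier_mat k k"
  shows "(four_block_mat (X + t \<cdot>\<^sub>m 1\<^sub>m k) (1\<^sub>m k) (1\<^sub>m k) (t \<cdot>\<^sub>m 1\<^sub>m k) - t \<cdot>\<^sub>m 1\<^sub>m (k + k))
    * four_block_mat (0\<^sub>m k k) (1\<^sub>m k) (1\<^sub>m k) (- X) = 1\<^sub>m (k + k)"
proof -
  have "four_block_mat (X + t \<cdot>\<^sub>m 1\<^sub>m k) (1\<^sub>m k) (1\<^sub>m k) (t \<cdot>\<^sub>m 1\<^sub>m k) - t \<cdot>\<^sub>m 1\<^sub>m (k + k)
    = four_block_mat X (1\<^sub>m k) (1\<^sub>m k) (0\<^sub>m k k)"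
    by (rule eq_matI) (use X in auto)
  moreover have "X + - X = 0\<^sub>m k k" by (rule eq_matI) (use X in auto)
  ultimately show ?thesis
    by (simp, subst mult_four_block_mat[of _ k k _ k _ k _ _ k _ k]) (use X in auto)
qed

text \<open>
  Let \<open>R\<close> be the matrix minus \<open>t\<close>: it is invertible on the first summand, of size \<open>2 k\<close>, and zero on
  the second.  Shears produce any block \<open>K\<close> below the first summand, because \<open>F R\<close> takes every value.  A
  suitable \<open>K\<close> with \<open>2 m\<close> rows attaches \<open>2 m\<close> coordinates of the scalar summand such that, when the
  \<open>2 k + 2 m\<close> coordinates are cut in the middle, the lower left block is a permutation matrix.
\<close>

lemma regularized_regroup:
  fixes X :: "'a::field mat"
  assumes X: "X \<in> carrier_mat k k" and m: "m \<le> k" "2 * m \<le> j"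
  obtains p q where "p \<in> carrier_mat (k + m) (k + m)" "q \<in> carrier_mat (k + m) (k + m)"
    "similar_mat (four_block_mat (four_block_mat (X + t \<cdot>\<^sub>m 1\<^sub>m k) (1\<^sub>m k) (1\<^sub>m k) (t \<cdot>\<^sub>m 1\<^sub>m k))
        (0\<^sub>m (k + k) j) (0\<^sub>m j (k + k)) (t \<cdot>\<^sub>m 1\<^sub>m j))
      (four_block_mat (companion_block (k + m) p q) (0\<^sub>m ((k + m) + (k + m)) (j - 2 * m))
        (0\<^sub>m (j - 2 * m) ((k + m) + (k + m))) (t \<cdot>\<^sub>m 1\<^sub>m (j - 2 * m)))"
proof -
  let ?n = "k + k" and ?l = "k + m" and ?r = "j - 2 * m"
  define G where "G = four_block_mat (X + t \<cdot>\<^sub>m 1\<^sub>m k) (1\<^sub>m k) (1\<^sub>m k) (t \<cdot>\<^sub>m 1\<^sub>m k)"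
  define R' where "R' = four_block_mat (0\<^sub>m k k) (1\<^sub>m k) (1\<^sub>m k) (- X)"
  define K :: "'a mat" where
    "K = mat (m + m) ?n (\<lambda>(r, c). if (if r < m then c = r else c = k + (r - m)) then 1 else 0)"
  have G: "G \<in> carrier_mat ?n ?n" and R': "R' \<in> carrier_mat ?n ?n" and K: "K \<in> carrier_mat (m + m) ?n"
    using X by (auto simp: G_def R'_def K_def)
  let ?S = "t \<cdot>\<^sub>m 1\<^sub>m (m + m) :: 'a mat"
  let ?D = "four_block_mat G (0\<^sub>m ?n (m + m)) (0\<^sub>m (m + m) ?n) ?S"
  define N where "N = four_block_mat G (0\<^sub>m ?n (m + m)) K ?S"
  have inv: "(G - t \<cdot>\<^sub>m 1\<^sub>m ?n) * R' = 1\<^sub>m ?n" using regularized_inverse[OF X] by (simp add: G_def R'_def)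
  have inv': "R' * (G - t \<cdot>\<^sub>m 1\<^sub>m ?n) = 1\<^sub>m ?n"
    by (rule mat_mult_left_right_inverse[OF _ R' inv]) (use G in simp)
  have DN: "similar_mat ?D N"
  proof -
    define F where "F = K * R'"
    have F: "F \<in> carrier_mat (m + m) ?n" using K R' by (simp add: F_def)
    have "F * (G - t \<cdot>\<^sub>m 1\<^sub>m ?n) = K"
      unfolding F_def using K R' G inv' by (simp add: assoc_mult_mat[of _ "m + m" ?n _ ?n _ ?n])
    then have "F * G - t \<cdot>\<^sub>m F = K"
      using F G by (simp add: mult_minus_distrib_mat[of _ "m + m" ?n _ ?n] mult_smult_distrib[of _ "m + m" ?n _ ?n])
    moreover have "F * G + 0\<^sub>m (m + m) ?n - ?S * F = F * G - t \<cdot>\<^sub>m F"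
      by (rule eq_matI) (use F G in \<open>auto simp: mult_smult_assoc_mat[of _ "m + m" "m + m" _ ?n] simp del: index_mult_mat(1)\<close>)
    ultimately show ?thesis
      using similar_lower_shear[OF G zero_carrier_mat zero_carrier_mat _ F, of ?S] G F by (simp add: N_def)
  qed
  \<comment> \<open>The cut at \<open>k + m\<close> leaves below it the last \<open>k - m\<close> rows of the old second block, which are unit
  rows with their ones in columns \<open>m, \<dots>, k - 1\<close>, and then the rows of \<open>K\<close>.\<close>
  define f where "f r = (if r < k - m then m + r else if r < k then r - (k - m) else r)" for r
  define g g' :: "'a mat" where "g = mat ?l ?l (\<lambda>(i, c). if c = f i then 1 else 0)"
    and "g' = mat ?l ?l (\<lambda>(i, c). if i = f c then 1 else 0)"
  have fl: "f i < ?l" if "i < ?l" for i using that m by (auto simp: f_def)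
  have fi: "f i = f c \<longleftrightarrow> i = c" if "i < ?l" "c < ?l" for i c using that m by (auto simp: f_def)
  have gg: "g * g' = 1\<^sub>m ?l"
    by (rule eq_matI) (use fl fi in \<open>auto simp: g_def g'_def scalar_prod_def if_distrib[of "\<lambda>x. x * _"] cong: if_cong\<close>)
  have cg: "g \<in> carrier_mat ?l ?l" "g' \<in> carrier_mat ?l ?l" by (auto simp: g_def g'_def)
  define a b d where "a = mat ?l ?l (\<lambda>(i, c). N $$ (i, c))" and "b = mat ?l ?l (\<lambda>(i, c). N $$ (i, ?l + c))"
    and "d = mat ?l ?l (\<lambda>(i, c). N $$ (?l + i, ?l + c))"
  have N: "N \<in> carrier_mat (?l + ?l) (?l + ?l)" using G K by (auto simp: N_def)
  have "mat ?l ?l (\<lambda>(i, c). N $$ (?l + i, c)) = g"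
    by (rule eq_matI) (use X m in \<open>auto simp: N_def G_def g_def f_def K_def\<close>)
  with four_block_split[OF N] have Ns: "N = four_block_mat a b g d" by (simp add: a_def b_def d_def)
  obtain p q where pq: "p \<in> carrier_mat ?l ?l" "q \<in> carrier_mat ?l ?l" and sim: "similar_mat N (companion_block ?l p q)"
    unfolding Ns using similar_companion_block[of a ?l b g d g', OF _ _ cg(1) _ cg(2) gg] cg
    by (metis (no_types, lifting) a_def add_carrier_mat b_def d_def mat_carrier minus_carrier_mat mult_carrier_mat)
  have eq: "four_block_mat G (0\<^sub>m ?n j) (0\<^sub>m j ?n) (t \<cdot>\<^sub>m 1\<^sub>m j)
    = four_block_mat ?D (0\<^sub>m (?l + ?l) ?r) (0\<^sub>m ?r (?l + ?l)) (t \<cdot>\<^sub>m 1\<^sub>m ?r)"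
    by (rule eq_matI) (use G m in auto)
  have "similar_mat (four_block_mat G (0\<^sub>m ?n j) (0\<^sub>m j ?n) (t \<cdot>\<^sub>m 1\<^sub>m j))
    (four_block_mat (companion_block ?l p q) (0\<^sub>m (?l + ?l) ?r) (0\<^sub>m ?r (?l + ?l)) (t \<cdot>\<^sub>m 1\<^sub>m ?r))"
    unfolding eq
    by (rule similar_mat_four_block_0_0[OF similar_mat_trans[OF DN sim] similar_mat_refl])
      (use G K in \<open>auto\<close>)
  then show ?thesis using that pq unfolding G_def by blast
qed

text \<open>
  Two steps make the companion part invertible after subtraction of \<open>t\<close>, so the coupling \<open>H\<close> can
  be removed and the parts regrouped.
\<close>

lemma companion_block_growth:
  fixes p :: "'a::field mat"
  assumes two: "(2::'a) \<noteq> 0" and p: "p \<in> carrier_mat k k" and q: "q \<in> carrier_mat k k"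
    and H: "H \<in> carrier_mat (k + k) j" and m: "m \<le> k" "2 * m \<le> j"
  obtains p' q' where "p' \<in> carrier_mat (k + m) (k + m)" "q' \<in> carrier_mat (k + m) (k + m)"
    "reduces (k + k + j) 2 (four_block_mat (companion_block k p q) H (0\<^sub>m j (k + k)) (t \<cdot>\<^sub>m 1\<^sub>m j))
      (four_block_mat (companion_block (k + m) p' q') (0\<^sub>m ((k + m) + (k + m)) (j - 2 * m))
        (0\<^sub>m (j - 2 * m) ((k + m) + (k + m))) (t \<cdot>\<^sub>m 1\<^sub>m (j - 2 * m)))"
proof -
  obtain X where X: "X \<in> carrier_mat k k" and r: "reduces (k + k) 2 (companion_block k p q)
      (four_block_mat (X + t \<cdot>\<^sub>m 1\<^sub>m k) (1\<^sub>m k) (1\<^sub>m k) (t \<cdot>\<^sub>m 1\<^sub>m k))" (is "reduces _ _ _ ?G")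
    by (rule companion_block_regularize[OF two p q])
  have G: "?G \<in> carrier_mat (k + k) (k + k)" using X by auto
  obtain H' where H': "H' \<in> carrier_mat (k + k) j" and
    r': "reduces (k + k + j) 2 (four_block_mat (companion_block k p q) H (0\<^sub>m j (k + k)) (t \<cdot>\<^sub>m 1\<^sub>m j))
      (four_block_mat ?G H' (0\<^sub>m j (k + k)) (t \<cdot>\<^sub>m 1\<^sub>m j))"
    by (rule reduces_upper_triangular[OF two r _ H, of "t \<cdot>\<^sub>m 1\<^sub>m j"]) auto
  have "similar_mat (four_block_mat ?G H' (0\<^sub>m j (k + k)) (t \<cdot>\<^sub>m 1\<^sub>m j))
    (four_block_mat ?G (0\<^sub>m (k + k) j) (0\<^sub>m j (k + k)) (t \<cdot>\<^sub>m 1\<^sub>m j))"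
    by (rule similar_decouple[OF G H' _ regularized_inverse[OF X]]) (use X in auto)
  moreover obtain p' q' where "p' \<in> carrier_mat (k + m) (k + m)" "q' \<in> carrier_mat (k + m) (k + m)"
    "similar_mat (four_block_mat ?G (0\<^sub>m (k + k) j) (0\<^sub>m j (k + k)) (t \<cdot>\<^sub>m 1\<^sub>m j))
      (four_block_mat (companion_block (k + m) p' q') (0\<^sub>m ((k + m) + (k + m)) (j - 2 * m))
        (0\<^sub>m (j - 2 * m) ((k + m) + (k + m))) (t \<cdot>\<^sub>m 1\<^sub>m (j - 2 * m)))"
    by (rule regularized_regroup[OF X m])
  ultimately show ?thesis using that reduces_similar_right[OF reduces_similar_right[OF r']] by blast
qed

section \<open>Reduction of a companion block with at most one scalar\<close>

lemma four_block_empty: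
  assumes "A \<in> carrier_mat n n" "B \<in> carrier_mat n 0" "D \<in> carrier_mat 0 0"
  shows "four_block_mat A B C D = A"
  by (rule eq_matI) (use assms in auto)

lemma reduces_to_idempotent_word_values:
  fixes A :: "'a::field mat"
  assumes two: "(2::'a) \<noteq> 0" and "reduces n m A E" "E * E = E"
  shows "A \<in> word_values n (m + 1)"
  using reduces_word_values[OF two assms(2) word_values_1] assms(3) reduces_carrier(2)[OF assms(2)]
  by (simp add: idempotents_mat[OF two])

lemma companion_block_word_values:
  fixes p :: "'a::field mat"
  assumes two: "(2::'a) \<noteq> 0" and p: "p \<in> carrier_mat k k" and q: "q \<in> carrier_mat k k"
  shows "companion_block k p q \<in> word_values (k + k) 5"
  using reduces_to_idempotent_word_values[OF two companion_block_to_idempotent[OF assms] companion_block_idempotent]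
  by simp

lemma diagonal_idempotent:
  assumes "\<And>i. i < n \<Longrightarrow> v i * v i = v i"
  shows "mat n n (\<lambda>(i, j). if i = j then v i else 0) * mat n n (\<lambda>(i, j). if i = j then v i else 0)
    = mat n n (\<lambda>(i, j). if i = j then v i else (0::'a::field))"
  by (rule eq_matI) (use assms in \<open>auto simp: scalar_prod_def if_distrib[of "\<lambda>x. x * _"] cong: if_cong\<close>)

text \<open>
  A diagonal matrix with two different entries is nonscalar, hence similar to the companion matrix
  with trace \<open>e + d\<close>.
\<close>

lemma scalar_pair_reduces:
  fixes e d :: "'a::field"
  assumes two: "(2::'a) \<noteq> 0" and ed: "e \<noteq> d" and t: "1 + 8 * (e + d) \<noteq> 0"
  shows "reduces (1 + 1) 3 (four_block_mat (e \<cdot>\<^sub>m 1\<^sub>m 1) (0\<^sub>m 1 1) (0\<^sub>m 1 1) (d \<cdot>\<^sub>m 1\<^sub>m 1))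
    (companion_block 1 (1\<^sub>m 1) (0\<^sub>m 1 1))" (is "reduces _ _ ?D _")
proof -
  define F where "F = (1 / (e - d)) \<cdot>\<^sub>m (1\<^sub>m 1 :: 'a mat)"
  have F: "F \<in> carrier_mat 1 1" by (simp add: F_def)
  have eqs: "e \<cdot>\<^sub>m 1\<^sub>m 1 - 0\<^sub>m 1 1 * F = e \<cdot>\<^sub>m 1\<^sub>m 1" "F * 0\<^sub>m 1 1 + d \<cdot>\<^sub>m 1\<^sub>m 1 = d \<cdot>\<^sub>m 1\<^sub>m 1"
    "F * (e \<cdot>\<^sub>m 1\<^sub>m 1) + 0\<^sub>m 1 1 - d \<cdot>\<^sub>m 1\<^sub>m 1 * F = 1\<^sub>m 1"
    by (rule eq_matI, use ed in \<open>auto simp: F_def diff_divide_distrib[symmetric]\<close>)+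
  have 1: "similar_mat ?D (four_block_mat (e \<cdot>\<^sub>m 1\<^sub>m 1) (0\<^sub>m 1 1) (1\<^sub>m 1) (d \<cdot>\<^sub>m 1\<^sub>m 1))"
    using similar_lower_shear[of "e \<cdot>\<^sub>m 1\<^sub>m 1" 1 "0\<^sub>m 1 1" 1 "0\<^sub>m 1 1" "d \<cdot>\<^sub>m 1\<^sub>m 1" F] F
    unfolding eqs by simp
  have "1\<^sub>m 1 * (e \<cdot>\<^sub>m 1\<^sub>m 1) * 1\<^sub>m 1 + d \<cdot>\<^sub>m 1\<^sub>m 1 = (e + d) \<cdot>\<^sub>m (1\<^sub>m 1 :: 'a mat)"
    by (rule eq_matI) auto
  then obtain q where q: "q \<in> carrier_mat 1 1"
    "similar_mat (four_block_mat (e \<cdot>\<^sub>m 1\<^sub>m 1) (0\<^sub>m 1 1) (1\<^sub>m 1) (d \<cdot>\<^sub>m 1\<^sub>m 1))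
      (companion_block 1 ((e + d) \<cdot>\<^sub>m 1\<^sub>m 1) q)"
    using similar_companion_block[of "e \<cdot>\<^sub>m 1\<^sub>m 1" 1 "0\<^sub>m 1 1" "1\<^sub>m 1" "d \<cdot>\<^sub>m 1\<^sub>m 1" "1\<^sub>m 1"]
    by (metis (no_types, lifting) add_carrier_mat left_mult_one_mat minus_carrier_mat mult_carrier_mat one_carrier_mat smult_carrier_mat zero_carrier_mat)
  show ?thesis
    by (rule reduces_similar[OF similar_mat_trans[OF 1 q(2)] companion_block_scalar_to_idempotent[OF two q(1) t]])
qed

text \<open>
  The idempotent is similar to a diagonal matrix with \<open>k\<close> ones and \<open>k\<close> zeros.  The scalar \<open>d\<close> is
  paired with one of these entries \<open>v\<close>; the rest stays as it is.  The condition \<open>1 + 8 (v + d) \<noteq> 0\<close> can be met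
  since its left sides for \<open>v = 0\<close> and \<open>v = 1\<close> differ by \<open>8 \<noteq> 0\<close>.
\<close>

lemma idempotent_plus_scalar_word_values:
  fixes d :: "'a::field"
  assumes two: "(2::'a) \<noteq> 0" and d: "d \<noteq> 0" "d \<noteq> 1" and k: "k \<ge> 1"
  shows "four_block_mat (companion_block k (1\<^sub>m k) (0\<^sub>m k k)) (0\<^sub>m (k + k) 1) (0\<^sub>m 1 (k + k)) (d \<cdot>\<^sub>m 1\<^sub>m 1)
    \<in> word_values (k + k + 1) 4"
proof -
  let ?n = "k + k + 1"
  define v where "v i = (if i < k then 1 else if i < k + k then 0 else d)" for i
  obtain a where a: "a = 0 \<or> a = k" "1 + 8 * (v a + d) \<noteq> 0"
  proof (cases "1 + 8 * (1 + d) = 0")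
    case True
    then have "1 + 8 * d = - 8" by (simp add: algebra_simps eq_neg_iff_add_eq_0)
    moreover have "(8::'a) = 2 * 2 * 2" by simp
    ultimately have "1 + 8 * d \<noteq> 0" using two by (metis mult_eq_0_iff neg_equal_0_iff_equal)
    then show ?thesis using that[of k] k by (simp add: v_def)
  next
    case False
    then show ?thesis using that[of 0] k by (simp add: v_def)
  qed
  \<comment> \<open>moves the entries at \<open>a\<close> and \<open>2 k\<close> to the first two places\<close>
  define f where "f = transpose 0 a \<circ> transpose 1 (k + k)"
  have f: "bij_betw f {..<?n} {..<?n}"
    unfolding f_def by (rule bij_betw_trans[of _ _ "{..<?n}"]) (use a k in \<open>auto simp: bij_betw_transpose_iff\<close>)
  have f0: "f 0 = a" and f1: "f 1 = k + k" using a k by (auto simp: f_def transpose_def)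
  have inj: "f i = f j \<longleftrightarrow> i = j" if "i < ?n" "j < ?n" for i j
    using f that by (auto simp: bij_betw_def inj_on_def)
  have fl: "f i < ?n" if "i < ?n" for i using f that by (auto simp: bij_betw_def)
  have vf: "v (f i) * v (f i) = v (f i)" if "i < ?n" "i \<noteq> 1" for i
    using inj[of i 1] fl[of i] that k f1 by (auto simp: v_def)
  define S where "S = mat (k + k - 1) (k + k - 1) (\<lambda>(i, j). if i = j then v (f (2 + i)) else 0)"
  have S: "S \<in> carrier_mat (k + k - 1) (k + k - 1)" by (simp add: S_def)
  have SS: "S * S = S" unfolding S_def by (rule diagonal_idempotent, rule vf) auto
  have "similar_mat (companion_block k (1\<^sub>m k) (0\<^sub>m k k)) (four_block_mat (1\<^sub>m k) (0\<^sub>m k k) (0\<^sub>m k k) (0\<^sub>m k k :: 'a mat))"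
  proof -
    define F where "F = - (1\<^sub>m k :: 'a mat)"
    have F: "F \<in> carrier_mat k k" by (simp add: F_def)
    have eqs: "1\<^sub>m k - 0\<^sub>m k k * F = 1\<^sub>m k" "F * 0\<^sub>m k k + 0\<^sub>m k k = 0\<^sub>m k k" "F * 1\<^sub>m k + 1\<^sub>m k - 0\<^sub>m k k * F = 0\<^sub>m k k"
      by (rule eq_matI, auto simp: F_def)+
    show ?thesis
      using similar_lower_shear[OF one_carrier_mat zero_carrier_mat one_carrier_mat zero_carrier_mat F]
      unfolding eqs companion_block_def .
  qed
  from similar_mat_four_block_0_0[OF this similar_mat_refl[of "d \<cdot>\<^sub>m 1\<^sub>m 1" 1], of "k + k" 1]
  have 1: "similar_mat (four_block_mat (companion_block k (1\<^sub>m k) (0\<^sub>m k k)) (0\<^sub>m (k + k) 1) (0\<^sub>m 1 (k + k)) (d \<cdot>\<^sub>m 1\<^sub>m 1))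
    (four_block_mat (four_block_mat (1\<^sub>m k) (0\<^sub>m k k) (0\<^sub>m k k) (0\<^sub>m k k)) (0\<^sub>m (k + k) 1) (0\<^sub>m 1 (k + k)) (d \<cdot>\<^sub>m 1\<^sub>m 1))"
    by simp
  have 2: "four_block_mat (four_block_mat (1\<^sub>m k) (0\<^sub>m k k) (0\<^sub>m k k) (0\<^sub>m k k)) (0\<^sub>m (k + k) 1) (0\<^sub>m 1 (k + k)) (d \<cdot>\<^sub>m 1\<^sub>m 1)
    = mat ?n ?n (\<lambda>(i, j). if i = j then v i else 0)"
    by (rule eq_matI) (auto simp: v_def)
  let ?B = "mat ?n ?n (\<lambda>(i, j). if i = j then v (f i) else 0)"
  have "mat ?n ?n (\<lambda>(i, j). mat ?n ?n (\<lambda>(i, j). if i = j then v i else 0) $$ (f i, f j)) = ?B"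
    using fl by (intro eq_matI) (auto simp: inj)
  then have 3: "similar_mat (mat ?n ?n (\<lambda>(i, j). if i = j then v i else 0)) ?B"
    using similar_reindex[OF _ f, of "mat ?n ?n (\<lambda>(i, j). if i = j then v i else 0)"] by simp
  let ?g = "four_block_mat (v a \<cdot>\<^sub>m 1\<^sub>m 1) (0\<^sub>m 1 1) (0\<^sub>m 1 1) (d \<cdot>\<^sub>m 1\<^sub>m 1)"
  have 4: "?B = four_block_mat ?g (0\<^sub>m 2 (k + k - 1)) (0\<^sub>m (k + k - 1) 2) S"
  proof (rule eq_matI)
    fix i j assume "i < dim_row (four_block_mat ?g (0\<^sub>m 2 (k + k - 1)) (0\<^sub>m (k + k - 1) 2) S)"
      "j < dim_col (four_block_mat ?g (0\<^sub>m 2 (k + k - 1)) (0\<^sub>m (k + k - 1) 2) S)"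
    then have ij: "i < ?n" "j < ?n" using k by (auto simp: S_def)
    consider "i = 0" | "i = 1" | "i \<ge> 2" by linarith
    then show "?B $$ (i, j) = four_block_mat ?g (0\<^sub>m 2 (k + k - 1)) (0\<^sub>m (k + k - 1) 2) S $$ (i, j)"
    proof cases
      case 1
      then show ?thesis using ij k f0 by (auto simp: S_def)
    next
      case 2
      then show ?thesis using ij k f1 by (auto simp: S_def v_def)
    next
      case 3
      then have "2 + (i - 2) = i" by simp
      then show ?thesis using ij k 3 by (auto simp: S_def simp del: add_2_eq_Suc add_2_eq_Suc')
    qed
  qed (use k in \<open>auto simp: S_def\<close>)
  have "v a \<noteq> d" using a(1) d k by (auto simp: v_def)
  from reduces_direct_sum[OF two scalar_pair_reduces[OF two this a(2)] S]
  have r: "reduces ?n 3 ?B (four_block_mat (companion_block 1 (1\<^sub>m 1) (0\<^sub>m 1 1)) (0\<^sub>m 2 (k + k - 1)) (0\<^sub>m (k + k - 1) 2) S)"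
    using k unfolding 4 by (simp add: numeral_2_eq_2)
  have c: "companion_block 1 (1\<^sub>m 1) (0\<^sub>m 1 1 :: 'a mat) \<in> carrier_mat 2 2"
    using companion_block_carrier[of "1\<^sub>m 1 :: 'a mat" 1 "0\<^sub>m 1 1"] by (simp add: numeral_2_eq_2)
  have "?B \<in> word_values ?n (3 + 1)"
    by (rule reduces_to_idempotent_word_values[OF two r idempotent_four_block[OF c companion_block_idempotent S SS]])
  then have "?B \<in> word_values ?n 4" by simp
  then show ?thesis
    using word_values_similar[OF two] 1 3 unfolding 2 by blast
qed

text \<open>
  If \<open>d\<close> is \<open>0\<close> or \<open>1\<close>, the companion part is first decoupled from \<open>d\<close> and then reduced to an
  idempotent, in six steps.  Otherwise the companion part is reduced to an idempotent \<open>E\<close> at once; as \<open>d\<close> is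
  not an eigenvalue of \<open>E\<close>, the matrix decouples, and the pair of \<open>d\<close> with an eigenvalue of \<open>E\<close> is reduced.
\<close>

lemma odd_triangular_word_values:
  fixes p :: "'a::field mat"
  assumes two: "(2::'a) \<noteq> 0" and p: "p \<in> carrier_mat k k" and q: "q \<in> carrier_mat k k"
    and H: "H \<in> carrier_mat (k + k) 1" and k: "k \<ge> 1"
  shows "four_block_mat (companion_block k p q) H (0\<^sub>m 1 (k + k)) (d \<cdot>\<^sub>m 1\<^sub>m 1) \<in> word_values (k + k + 1) 8"
    (is "?A \<in> _")
proof -
  let ?E = "companion_block k (1\<^sub>m k) (0\<^sub>m k k) :: 'a mat"
  have E: "?E \<in> carrier_mat (k + k) (k + k)" by simp
  show ?thesis
  proof (cases "d = 0 \<or> d = 1")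
    case True
    obtain p' q' where pq: "p' \<in> carrier_mat (k + 0) (k + 0)" "q' \<in> carrier_mat (k + 0) (k + 0)"
      and r: "reduces (k + k + 1) 2 ?A (four_block_mat (companion_block (k + 0) p' q') (0\<^sub>m ((k + 0) + (k + 0)) (1 - 2 * 0))
        (0\<^sub>m (1 - 2 * 0) ((k + 0) + (k + 0))) (d \<cdot>\<^sub>m 1\<^sub>m (1 - 2 * 0)))"
      by (rule companion_block_growth[OF two p q H, of 0 d]) auto
    have r': "reduces (k + k + 1) 4 (four_block_mat (companion_block k p' q') (0\<^sub>m (k + k) 1) (0\<^sub>m 1 (k + k)) (d \<cdot>\<^sub>m 1\<^sub>m 1))
      (four_block_mat ?E (0\<^sub>m (k + k) 1) (0\<^sub>m 1 (k + k)) (d \<cdot>\<^sub>m 1\<^sub>m 1))"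
      by (rule reduces_direct_sum[OF two companion_block_to_idempotent[OF two]]) (use pq in auto)
    have dd: "(d \<cdot>\<^sub>m 1\<^sub>m 1) * (d \<cdot>\<^sub>m 1\<^sub>m 1) = d \<cdot>\<^sub>m (1\<^sub>m 1 :: 'a mat)"
      by (rule eq_matI) (use True in auto)
    have "?A \<in> word_values (k + k + 1) (6 + 1)"
      by (rule reduces_to_idempotent_word_values[OF two _ idempotent_four_block[OF E companion_block_idempotent _ dd]])
        (use reduces_trans[OF r, of 4] r' in auto)
    then show ?thesis using word_values_mono[OF two, of 7 8] by auto
  next
    case False
    obtain H' where H': "H' \<in> carrier_mat (k + k) 1" and r: "reduces (k + k + 1) 4 ?A
      (four_block_mat ?E H' (0\<^sub>m 1 (k + k)) (d \<cdot>\<^sub>m 1\<^sub>m 1))"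
      by (rule reduces_upper_triangular[OF two companion_block_to_idempotent[OF two p q] _ H, of "d \<cdot>\<^sub>m 1\<^sub>m 1"]) auto
    \<comment> \<open>the inverse of \<open>E - d\<close>, from \<open>E\<^sup>2 = E\<close>\<close>
    define R' where "R' = (1 / (d * (1 - d))) \<cdot>\<^sub>m (?E - (1 - d) \<cdot>\<^sub>m 1\<^sub>m (k + k))"
    have R': "R' \<in> carrier_mat (k + k) (k + k)" by (simp add: R'_def)
    have "(?E - d \<cdot>\<^sub>m 1\<^sub>m (k + k)) * (?E - (1 - d) \<cdot>\<^sub>m 1\<^sub>m (k + k)) = (d * (1 - d)) \<cdot>\<^sub>m 1\<^sub>m (k + k)"
    proof -
      have "(?E - d \<cdot>\<^sub>m 1\<^sub>m (k + k)) * (?E - (1 - d) \<cdot>\<^sub>m 1\<^sub>m (k + k)) = ?E * ?E - d \<cdot>\<^sub>m ?E - (1 - d) \<cdot>\<^sub>m (?E - d \<cdot>\<^sub>m 1\<^sub>m (k + k))"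
        using E left_mult_one_mat[OF E] by (simp add: minus_mult_distrib_mat[of _ "k + k" "k + k" _ _ "k + k"] mult_minus_distrib_mat[of _ "k + k" "k + k" _ "k + k"]
          mult_smult_assoc_mat[of _ "k + k" "k + k" _ "k + k"] mult_smult_distrib[of _ "k + k" "k + k" _ "k + k"] smult_smult_mat)
      also have "\<dots> = (d * (1 - d)) \<cdot>\<^sub>m 1\<^sub>m (k + k)"
        unfolding companion_block_idempotent by (rule eq_matI) (use carrier_matD[OF E] in \<open>auto simp: algebra_simps\<close>)
      finally show ?thesis .
    qed
    then have inv: "(?E - d \<cdot>\<^sub>m 1\<^sub>m (k + k)) * R' = 1\<^sub>m (k + k)"
      unfolding R'_def using False E by (simp add: mult_smult_distrib[of _ "k + k" "k + k" _ "k + k"] smult_smult_mat)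
    have "four_block_mat ?E (0\<^sub>m (k + k) 1) (0\<^sub>m 1 (k + k)) (d \<cdot>\<^sub>m 1\<^sub>m 1) \<in> word_values (k + k + 1) 4"
      by (rule idempotent_plus_scalar_word_values[OF two _ _ k]) (use False in auto)
    from reduces_word_values[OF two reduces_similar_right[OF r similar_decouple[OF E H' R' inv]] this]
    show ?thesis by simp
  qed
qed

text \<open>
  Each doubling of \<open>k\<close> costs two steps; \<open>a\<close> counts the doublings that are still available.  A
  last incomplete doubling leaves at most one scalar.
\<close>

lemma companion_block_plus_scalar_word_values:
  fixes p :: "'a::field mat"
  assumes two: "(2::'a) \<noteq> 0"
  shows "k \<ge> 1 \<Longrightarrow> k + k + j \<le> 2 ^ (a + 1) * k \<Longrightarrow> p \<in> carrier_mat k k \<Longrightarrow> q \<in> carrier_mat k k \<Longrightarrow>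
    H \<in> carrier_mat (k + k) j \<Longrightarrow>
    four_block_mat (companion_block k p q) H (0\<^sub>m j (k + k)) (t \<cdot>\<^sub>m 1\<^sub>m j) \<in> word_values (k + k + j) (2 * a + 8)"
proof (induction a arbitrary: k j p q H)
  have base: "four_block_mat (companion_block k p q) H (0\<^sub>m j (k + k)) (t \<cdot>\<^sub>m 1\<^sub>m j) \<in> word_values (k + k + j) b"
    if "k \<ge> 1" "j \<le> 1" "p \<in> carrier_mat k k" "q \<in> carrier_mat k k" "H \<in> carrier_mat (k + k) j" "8 \<le> b"
    for k j p q H b
  proof (cases "j = 0")
    case True
    then have "four_block_mat (companion_block k p q) H (0\<^sub>m j (k + k)) (t \<cdot>\<^sub>m 1\<^sub>m j) = companion_block k p q"
      using four_block_empty[of "companion_block k p q" "k + k" H] that by simp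
    then show ?thesis
      using companion_block_word_values[OF two that(3,4)] word_values_mono[OF two, of 5 b] that True by auto
  next
    case False
    then have "j = 1" using that by simp
    then show ?thesis
      using odd_triangular_word_values[OF two that(3,4)] word_values_mono[OF two, of 8 b] that by auto
  qed
  {
    case 0
    then show ?case by (intro base) auto
  next
    case (Suc a)
    show ?case
    proof (cases "j \<le> 1")
      case True
      then show ?thesis using Suc.prems by (intro base) auto
    next
      case False
      define m where "m = min k (j div 2)"
      have m: "m \<le> k" "2 * m \<le> j" by (auto simp: m_def)
      let ?k = "k + m" and ?j = "j - 2 * m"
      have n: "?k + ?k + ?j = k + k + j" using m by simp
      obtain p' q' where pq: "p' \<in> carrier_mat ?k ?k" "q' \<in> carrier_mat ?k ?k" and
        r: "reduces (k + k + j) 2 (four_block_mat (companion_block k p q) H (0\<^sub>m j (k + k)) (t \<cdot>\<^sub>m 1\<^sub>m j))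
          (four_block_mat (companion_block ?k p' q') (0\<^sub>m (?k + ?k) ?j) (0\<^sub>m ?j (?k + ?k)) (t \<cdot>\<^sub>m 1\<^sub>m ?j))"
        by (rule companion_block_growth[OF two Suc.prems(3-5) m])
      have "four_block_mat (companion_block ?k p' q') (0\<^sub>m (?k + ?k) ?j) (0\<^sub>m ?j (?k + ?k)) (t \<cdot>\<^sub>m 1\<^sub>m ?j)
        \<in> word_values (?k + ?k + ?j) (2 * a + 8)"
      proof (cases "k \<le> j div 2")
        case True
        then have "?k = 2 * k" by (simp add: m_def)
        then have "?k + ?k + ?j \<le> 2 ^ (a + 1) * ?k" using Suc.prems(2) unfolding n by (simp add: algebra_simps)
        then show ?thesis using Suc.prems pq by (intro Suc.IH) auto
      next
        case False
        then have "?j \<le> 1" by (auto simp: m_def)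
        then show ?thesis using Suc.prems pq by (intro base) auto
      qed
      from reduces_word_values[OF two r this[unfolded n]] show ?thesis by simp
    qed
  }
qed

section \<open>Odd size: making the matrix block triangular\<close>

text \<open>
  Blocks on top of each other and side by side, as degenerate block matrices, so that the
  multiplication of four blocks applies.
\<close>

definition stack :: "'a::field mat \<Rightarrow> 'a mat \<Rightarrow> 'a mat" where
  "stack a b = four_block_mat a (0\<^sub>m (dim_row a) 0) b (0\<^sub>m (dim_row b) 0)"

definition beside :: "'a::field mat \<Rightarrow> 'a mat \<Rightarrow> 'a mat" where
  "beside a b = four_block_mat a b (0\<^sub>m 0 (dim_col a)) (0\<^sub>m 0 (dim_col b))"

lemma stack_carrier [simp]: "a \<in> carrier_mat m l \<Longrightarrow> b \<in> carrier_mat k l \<Longrightarrow> stack a b \<in> carrier_mat (m + k) l"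
  unfolding stack_def by (rule carrier_matI) auto

lemma beside_carrier [simp]: "a \<in> carrier_mat l m \<Longrightarrow> b \<in> carrier_mat l k \<Longrightarrow> beside a b \<in> carrier_mat l (m + k)"
  unfolding beside_def by (rule carrier_matI) auto

lemma stack_dim [simp]: "dim_row (stack a b) = dim_row a + dim_row b" "dim_col (stack a b) = dim_col a"
  by (simp_all add: stack_def)

lemma beside_dim [simp]: "dim_row (beside a b) = dim_row a" "dim_col (beside a b) = dim_col a + dim_col b"
  by (simp_all add: beside_def)

lemma stack_index:
  assumes "a \<in> carrier_mat m l" "b \<in> carrier_mat k l" "i < m + k" "j < l"
  shows "stack a b $$ (i, j) = (if i < m then a $$ (i, j) else b $$ (i - m, j))"
  using assms by (simp add: stack_def)

lemma beside_index:
  assumes "a \<in> carrier_mat l m" "b \<in> carrier_mat l k" "i < l" "j < m + k"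
  shows "beside a b $$ (i, j) = (if j < m then a $$ (i, j) else b $$ (i, j - m))"
  using assms by (simp add: beside_def)

lemma four_block_times_stack:
  assumes "A \<in> carrier_mat m k" "B \<in> carrier_mat m l" "C \<in> carrier_mat n k" "D \<in> carrier_mat n l"
    and "X \<in> carrier_mat k r" "Y \<in> carrier_mat l r"
  shows "four_block_mat A B C D * stack X Y = stack (A * X + B * Y) (C * X + D * Y)"
  unfolding stack_def
  by (subst mult_four_block_mat[of _ m k _ l _ n _ _ r _ 0]) (use assms in auto)

lemma beside_times_four_block:
  assumes "A \<in> carrier_mat m k" "B \<in> carrier_mat m l" "C \<in> carrier_mat n k" "D \<in> carrier_mat n l"
    and "X \<in> carrier_mat r m" "Y \<in> carrier_mat r n"
  shows "beside X Y * four_block_mat A B C D = beside (X * A + Y * C) (X * B + Y * D)"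
  unfolding beside_def
  by (subst mult_four_block_mat[of _ r m _ n _ 0 _ _ k _ l]) (use assms in auto)

lemma beside_times_stack:
  assumes "X \<in> carrier_mat r m" "Y \<in> carrier_mat r n" "U \<in> carrier_mat m s" "V \<in> carrier_mat n s"
  shows "beside X Y * stack U V = X * U + Y * V"
proof -
  have "beside X Y * stack U V = four_block_mat (X * U + Y * V) (0\<^sub>m r 0) (0\<^sub>m 0 s) (0\<^sub>m 0 0)"
    unfolding beside_def stack_def
    by (subst mult_four_block_mat[of _ r m _ n _ 0 _ _ s _ 0]) (use assms in auto)
  also have "\<dots> = X * U + Y * V" by (rule eq_matI) (use assms in auto)
  finally show ?thesis .
qed

lemma stack_times_beside:
  assumes "U \<in> carrier_mat m s" "V \<in> carrier_mat n s" "X \<in> carrier_mat s k" "Y \<in> carrier_mat s l"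
  shows "stack U V * beside X Y = four_block_mat (U * X) (U * Y) (V * X) (V * Y)"
  unfolding beside_def stack_def
  by (subst mult_four_block_mat[of _ m s _ 0 _ n _ _ k _ l]) (use assms in auto)

lemma stack_split:
  assumes "A \<in> carrier_mat (m + k) l"
  obtains a b where "a \<in> carrier_mat m l" "b \<in> carrier_mat k l" "A = stack a b"
proof
  show "A = stack (mat m l (\<lambda>(i, j). A $$ (i, j))) (mat k l (\<lambda>(i, j). A $$ (m + i, j)))"
    unfolding stack_def by (rule eq_matI) (use assms in auto)
qed auto

text \<open>
  The step for companion blocks keeps the shape of a coupling that enters through the first block
  and leaves through the second one.
\<close>

lemma coupled_companion_block_step:
  fixes p :: "'a::field mat"
  assumes two: "(2::'a) \<noteq> 0" and p: "p \<in> carrier_mat k k" and q: "q \<in> carrier_mat k k"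
    and p': "p' \<in> carrier_mat k k" and h: "h \<in> carrier_mat k l" and r: "r \<in> carrier_mat l k"
    and S: "S \<in> carrier_mat l l"
  shows "reduces (k + k + l) 1
    (four_block_mat (companion_block k p q) (stack h (0\<^sub>m k l)) (beside (0\<^sub>m l k) r) S)
    (four_block_mat (companion_block k p' (4 \<cdot>\<^sub>m q + p * p - p * p'))
      (stack (2 \<cdot>\<^sub>m h) (0\<^sub>m k l)) (beside (0\<^sub>m l k) (2 \<cdot>\<^sub>m r)) S)"
    (is "reduces _ _ ?A ?A'")
proof -
  let ?B = "four_block_mat p (2 \<cdot>\<^sub>m q) (2 \<cdot>\<^sub>m 1\<^sub>m k) (p' - p)"
  let ?E = "four_block_mat (1\<^sub>m k) (0\<^sub>m k k) (0\<^sub>m k k) (0\<^sub>m k k) :: 'a mat"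
  let ?H = "stack h (0\<^sub>m k l)" and ?K = "beside (0\<^sub>m l k) r"
  let ?w = "2 \<cdot>\<^sub>m 1\<^sub>m (k + k) - ?E"
  let ?q = "4 \<cdot>\<^sub>m q + p * p - p * p'"
  have B: "?B \<in> carrier_mat (k + k) (k + k)" using p p' by (intro four_block_carrier_mat) auto
  have E: "?E \<in> carrier_mat (k + k) (k + k)" by simp
  have w: "?w = four_block_mat (1\<^sub>m k) (0\<^sub>m k k) (0\<^sub>m k k) (2 \<cdot>\<^sub>m 1\<^sub>m k)"
    by (rule eq_matI) auto
  have wH: "?w * ?H = stack h (0\<^sub>m k l)" unfolding w
    by (subst four_block_times_stack[of _ k k _ k _ k _ _ l]) (use h in auto)
  have Kw: "?K * ?w = beside (0\<^sub>m l k) (2 \<cdot>\<^sub>m r)" unfolding w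
    by (subst beside_times_four_block[of _ k k _ k _ k _ _ l]) (use r in \<open>auto simp: mult_smult_distrib[of _ l k _ k]\<close>)
  let ?D = "four_block_mat ?B (stack h (0\<^sub>m k l)) (beside (0\<^sub>m l k) (2 \<cdot>\<^sub>m r)) S"
  have A: "?A = jordan_product ?D (four_block_mat ?E (0\<^sub>m (k + k) l) (0\<^sub>m l (k + k)) (1\<^sub>m l))"
    using jordan_product_four_block[OF two B E companion_block_corner_idempotent, of ?H l ?K S]
      companion_block_jordan_product[OF two p q, of "p' - p"] p p' h r S unfolding wH Kw by simp
  let ?P = "four_block_mat ((1/2) \<cdot>\<^sub>m 1\<^sub>m k) (- ((1/2) \<cdot>\<^sub>m (p' - p))) (0\<^sub>m k k) (1\<^sub>m k)"
  let ?Q = "four_block_mat (2 \<cdot>\<^sub>m 1\<^sub>m k) (p' - p) (0\<^sub>m k k) (1\<^sub>m k)"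
  have "similar_mat_wit ?D ?A'
    (four_block_mat ?P (0\<^sub>m (k + k) l) (0\<^sub>m l (k + k)) (1\<^sub>m l))
    (four_block_mat ?Q (0\<^sub>m (k + k) l) (0\<^sub>m l (k + k)) (1\<^sub>m l))"
  proof (rule similar_mat_wit_four_block[OF companion_block_step_wit[OF two p q p'] similar_mat_wit_refl[OF S]])
    have "?P * stack (2 \<cdot>\<^sub>m h) (0\<^sub>m k l) = stack h (0\<^sub>m k l)"
      by (subst four_block_times_stack[of _ k k _ k _ k _ _ l])
        (use two h p p' in \<open>auto simp: mult_smult_distrib[of _ k k _ l] mult_smult_assoc_mat[of _ k k _ l] smult_smult_mat\<close>)
    moreover have "stack h (0\<^sub>m k l) * 1\<^sub>m l = stack h (0\<^sub>m k l)"
      by (rule right_mult_one_mat[of _ "k + k"]) (use h in auto)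
    ultimately show "stack h (0\<^sub>m k l) = ?P * stack (2 \<cdot>\<^sub>m h) (0\<^sub>m k l) * 1\<^sub>m l" by simp
    have "beside (0\<^sub>m l k) (2 \<cdot>\<^sub>m r) * ?Q = beside (0\<^sub>m l k) (2 \<cdot>\<^sub>m r)"
      by (subst beside_times_four_block[of _ k k _ k _ k _ _ l]) (use r p p' in auto)
    moreover have "1\<^sub>m l * beside (0\<^sub>m l k) (2 \<cdot>\<^sub>m r) = beside (0\<^sub>m l k) (2 \<cdot>\<^sub>m r)"
      by (rule left_mult_one_mat[of _ _ "k + k"]) (use r in auto)
    ultimately show "beside (0\<^sub>m l k) (2 \<cdot>\<^sub>m r) = 1\<^sub>m l * beside (0\<^sub>m l k) (2 \<cdot>\<^sub>m r) * ?Q" by simp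
  qed (use B h r S in auto)
  then have "similar_mat ?D ?A'" unfolding similar_mat_def by blast
  then have red: "reduces (k + k + l) 0 ?D ?A'" using B S by (intro reduces.similar) auto
  have cA: "?A \<in> carrier_mat (k + k + l) (k + k + l)" using p q S by auto
  have sim: "similar_mat ?A (jordan_product ?D (four_block_mat ?E (0\<^sub>m (k + k) l) (0\<^sub>m l (k + k)) (1\<^sub>m l)))"
    using similar_mat_refl[OF cA] unfolding A .
  show ?thesis
    using reduces.step[OF _ idempotent_four_block[OF E companion_block_corner_idempotent one_carrier_mat] _ sim red] B S
    by simp
qed

lemma companion_block_minus:
  assumes "p \<in> carrier_mat k k" "q \<in> carrier_mat k k" "x \<in> carrier_mat k k" "y \<in> carrier_mat k k"
  shows "companion_block k p q - four_block_mat x y (0\<^sub>m k k) (0\<^sub>m k k) = companion_block k (p - x) (q - y)"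
  unfolding companion_block_def by (rule eq_matI) (use assms in auto)

text \<open>
  The aim is a left eigenvector \<open>(\<alpha>, \<beta>, 1)\<close>, whose kernel is an invariant complement of the last
  coordinate.  After two steps, with \<open>h\<close> and \<open>r\<close> multiplied by \<open>4\<close>, the eigenvalue equations are
  \<open>\<alpha> p\<^sub>2 + \<beta> = d \<alpha>\<close>, \<open>\<alpha> q\<^sub>2 + 4 r = d \<beta>\<close> and \<open>4 \<alpha> h + s = d\<close>.  The last one defines \<open>d\<close> and the first one
  \<open>\<beta>\<close>.  With \<open>p\<^sub>1 = d - 1\<close> the middle one prescribes \<open>\<alpha> p\<^sub>2\<close> without any inversion; for \<open>\<alpha> = (1, 0, \<dots>, 0)\<close>
  this is the first row of the free matrix \<open>p\<^sub>2\<close>.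
\<close>

lemma odd_triangularize:
  fixes p :: "'a::field mat"
  assumes two: "(2::'a) \<noteq> 0" and p: "p \<in> carrier_mat k k" and q: "q \<in> carrier_mat k k"
    and h: "h \<in> carrier_mat k 1" and r: "r \<in> carrier_mat 1 k" and k: "k \<ge> 1"
  obtains p' q' H d where "p' \<in> carrier_mat k k" "q' \<in> carrier_mat k k" "H \<in> carrier_mat (k + k) 1"
    "reduces (k + k + 1) 2
      (four_block_mat (companion_block k p q) (stack h (0\<^sub>m k 1)) (beside (0\<^sub>m 1 k) r) (s \<cdot>\<^sub>m 1\<^sub>m 1))
      (four_block_mat (companion_block k p' q') H (0\<^sub>m 1 (k + k)) (d \<cdot>\<^sub>m 1\<^sub>m 1))"
proof -
  define \<alpha> where "\<alpha> = mat 1 k (\<lambda>(i, j). if j = 0 then 1 else (0::'a))"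
  have \<alpha>: "\<alpha> \<in> carrier_mat 1 k" by (simp add: \<alpha>_def)
  have \<alpha>_mult: "\<alpha> * Y = mat 1 c (\<lambda>(i, j). Y $$ (0, j))" if "Y \<in> carrier_mat k c" for Y c
    by (rule eq_matI) (use that k in \<open>auto simp: \<alpha>_def scalar_prod_def if_distrib[of "\<lambda>x. x * _"] cong: if_cong\<close>)
  define d where "d = s + 4 * h $$ (0, 0)"
  define p1 where "p1 = (d - 1) \<cdot>\<^sub>m (1\<^sub>m k :: 'a mat)"
  define q1 where "q1 = 4 \<cdot>\<^sub>m q + p * p - p * p1"
  define M where "M = 4 \<cdot>\<^sub>m q1 + p1 * p1"
  define \<rho> where "\<rho> = (d * d) \<cdot>\<^sub>m \<alpha> - 4 \<cdot>\<^sub>m r - \<alpha> * M"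
  define p2 where "p2 = mat k k (\<lambda>(i, j). if i = 0 then \<rho> $$ (0, j) else 0)"
  define q2 where "q2 = M - p1 * p2"
  define \<beta> where "\<beta> = d \<cdot>\<^sub>m \<alpha> - \<rho>"
  have c: "p1 \<in> carrier_mat k k" "q1 \<in> carrier_mat k k" "M \<in> carrier_mat k k" "\<rho> \<in> carrier_mat 1 k"
    "p2 \<in> carrier_mat k k" "q2 \<in> carrier_mat k k" "\<beta> \<in> carrier_mat 1 k"
    using p q r \<alpha> by (auto simp: p1_def q1_def M_def \<rho>_def p2_def q2_def \<beta>_def)
  have \<alpha>p2: "\<alpha> * p2 = \<rho>" unfolding \<alpha>_mult[OF c(5)] by (rule eq_matI) (use c(4) k in \<open>auto simp: p2_def\<close>)
  let ?h = "4 \<cdot>\<^sub>m h" and ?r = "4 \<cdot>\<^sub>m r"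
  have r2: "reduces (k + k + 1) 2
      (four_block_mat (companion_block k p q) (stack h (0\<^sub>m k 1)) (beside (0\<^sub>m 1 k) r) (s \<cdot>\<^sub>m 1\<^sub>m 1))
      (four_block_mat (companion_block k p2 q2) (stack ?h (0\<^sub>m k 1)) (beside (0\<^sub>m 1 k) ?r) (s \<cdot>\<^sub>m 1\<^sub>m 1))"
  proof -
    have "reduces (k + k + 1) 1
      (four_block_mat (companion_block k p q) (stack h (0\<^sub>m k 1)) (beside (0\<^sub>m 1 k) r) (s \<cdot>\<^sub>m 1\<^sub>m 1))
      (four_block_mat (companion_block k p1 q1) (stack (2 \<cdot>\<^sub>m h) (0\<^sub>m k 1)) (beside (0\<^sub>m 1 k) (2 \<cdot>\<^sub>m r)) (s \<cdot>\<^sub>m 1\<^sub>m 1))"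
      unfolding q1_def by (rule coupled_companion_block_step[OF two p q c(1) h r]) simp
    moreover have "reduces (k + k + 1) 1
      (four_block_mat (companion_block k p1 q1) (stack (2 \<cdot>\<^sub>m h) (0\<^sub>m k 1)) (beside (0\<^sub>m 1 k) (2 \<cdot>\<^sub>m r)) (s \<cdot>\<^sub>m 1\<^sub>m 1))
      (four_block_mat (companion_block k p2 q2) (stack (2 \<cdot>\<^sub>m (2 \<cdot>\<^sub>m h)) (0\<^sub>m k 1)) (beside (0\<^sub>m 1 k) (2 \<cdot>\<^sub>m (2 \<cdot>\<^sub>m r))) (s \<cdot>\<^sub>m 1\<^sub>m 1))"
      unfolding q2_def M_def by (rule coupled_companion_block_step[OF two c(1,2,5)]) (use h r in auto)
    ultimately show ?thesis using reduces_trans by (fastforce simp: smult_smult_mat numeral_2_eq_2[symmetric])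
  qed
  let ?F = "beside \<alpha> \<beta>"
  let ?A = "companion_block k p2 q2" and ?B = "stack ?h (0\<^sub>m k 1)" and ?C = "beside (0\<^sub>m 1 k) ?r"
  have cB: "?B \<in> carrier_mat (k + k) 1" and cC: "?C \<in> carrier_mat 1 (k + k)" and cF: "?F \<in> carrier_mat 1 (k + k)"
    using h r \<alpha> c by auto
  have FB: "?F * ?B + s \<cdot>\<^sub>m 1\<^sub>m 1 = d \<cdot>\<^sub>m 1\<^sub>m 1"
  proof -
    have "?F * ?B = \<alpha> * ?h" by (subst beside_times_stack[of _ 1 k _ k _ 1]) (use h \<alpha> c in auto)
    also have "\<dots> + s \<cdot>\<^sub>m 1\<^sub>m 1 = d \<cdot>\<^sub>m 1\<^sub>m 1"
      using h k by (subst \<alpha>_mult[of _ 1]) (auto intro!: eq_matI simp: d_def)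
    finally show ?thesis .
  qed
  have FA: "?F * ?A = beside (\<rho> + \<beta>) (\<alpha> * q2)" unfolding companion_block_def
    by (subst beside_times_four_block[of _ k k _ k _ k _ _ 1]) (use c \<alpha> \<alpha>p2 in auto)
  have "?F * ?A + ?C - (d \<cdot>\<^sub>m 1\<^sub>m 1) * ?F = 0\<^sub>m 1 (k + k)"
  proof -
    have dF: "(d \<cdot>\<^sub>m 1\<^sub>m 1) * ?F = d \<cdot>\<^sub>m ?F" using cF left_mult_one_mat[OF cF] by (simp add: mult_smult_assoc_mat[of _ 1 1 _ "k + k"])
    have "\<alpha> * q2 = \<alpha> * M - (d - 1) \<cdot>\<^sub>m \<rho>"
      unfolding q2_def p1_def using c \<alpha> \<alpha>p2
      by (simp add: mult_minus_distrib_mat[of _ 1 k _ k] mult_smult_assoc_mat[of _ k k _ k] mult_smult_distrib[of _ 1 k _ k])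
    then have "(\<alpha> * q2) $$ (0, j) + 4 * r $$ (0, j) = d * \<beta> $$ (0, j)" if "j < k" for j
      using that c \<alpha> r by (simp add: \<beta>_def \<rho>_def algebra_simps del: index_mult_mat(1))
    moreover have "(\<rho> + \<beta>) $$ (0, j) = d * \<alpha> $$ (0, j)" if "j < k" for j
      using that c \<alpha> by (simp add: \<beta>_def)
    moreover define u v where "u = \<rho> + \<beta>" and "v = \<alpha> * q2"
    moreover have "u \<in> carrier_mat 1 k" "v \<in> carrier_mat 1 k" using \<alpha> c by (auto simp: u_def v_def)
    ultimately have uv: "u \<in> carrier_mat 1 k" "v \<in> carrier_mat 1 k"
      "\<And>j. j < k \<Longrightarrow> v $$ (0, j) + 4 * r $$ (0, j) = d * \<beta> $$ (0, j)" "\<And>j. j < k \<Longrightarrow> u $$ (0, j) = d * \<alpha> $$ (0, j)"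
      by auto
    show ?thesis unfolding FA dF u_def[symmetric] v_def[symmetric] using c(7) \<alpha> r uv
      by (intro eq_matI) (auto simp: beside_index[of _ 1 k _ k, simplified])
  qed
  moreover have "?A - ?B * ?F = companion_block k (p2 - ?h * \<alpha>) (q2 - ?h * \<beta>)"
  proof -
    have "?B * ?F = four_block_mat (?h * \<alpha>) (?h * \<beta>) (0\<^sub>m k k) (0\<^sub>m k k)"
      by (subst stack_times_beside[of _ k 1 _ k _ k _ k]) (use h \<alpha> c in auto)
    then show ?thesis
      using companion_block_minus[OF c(5,6) mult_carrier_mat[of ?h k 1 \<alpha> k] mult_carrier_mat[of ?h k 1 \<beta> k]] h \<alpha> c(7)
      by simp
  qed
  ultimately have "similar_mat (four_block_mat ?A ?B ?C (s \<cdot>\<^sub>m 1\<^sub>m 1))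
      (four_block_mat (companion_block k (p2 - ?h * \<alpha>) (q2 - ?h * \<beta>)) ?B (0\<^sub>m 1 (k + k)) (d \<cdot>\<^sub>m 1\<^sub>m 1))"
    using similar_lower_shear[OF companion_block_carrier[OF c(5,6)] cB cC _ cF, of "s \<cdot>\<^sub>m 1\<^sub>m 1"] FB by simp
  note red = reduces_similar_right[OF r2 this]
  have h4: "?h \<in> carrier_mat k 1" using h by simp
  show ?thesis
    by (rule that[OF minus_carrier_mat[OF mult_carrier_mat[OF h4 \<alpha>]]
      minus_carrier_mat[OF mult_carrier_mat[OF h4 c(7)]] cB red])
qed

text \<open>
  The conjugating matrix has second block row \<open>(0, 1)\<close>, so the row \<open>(0, r)\<close> is not changed.
\<close>

lemma similar_coupled_companion_block:
  fixes a :: "'a::field mat"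
  assumes a: "a \<in> carrier_mat k k" and b: "b \<in> carrier_mat k k" and g: "g \<in> carrier_mat k k"
    and d: "d \<in> carrier_mat k k" and g': "g' \<in> carrier_mat k k" and gg: "g * g' = 1\<^sub>m k"
    and H: "H \<in> carrier_mat (k + k) j" and r: "r \<in> carrier_mat j k" and S: "S \<in> carrier_mat j j"
  obtains p q H' where "p \<in> carrier_mat k k" "q \<in> carrier_mat k k" "H' \<in> carrier_mat (k + k) j"
    "similar_mat (four_block_mat (four_block_mat a b g d) H (beside (0\<^sub>m j k) r) S)
      (four_block_mat (companion_block k p q) H' (beside (0\<^sub>m j k) r) S)"
proof -
  let ?p = "g * a * g' + d"
  let ?q = "g * b + d * d - ?p * d"
  let ?Q = "four_block_mat g d (0\<^sub>m k k) (1\<^sub>m k)"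
  note w = similar_wit_companion_block[OF a b g d g' gg]
  have ca: "four_block_mat a b g d \<in> carrier_mat (k + k) (k + k)" using a d by auto
  note wD = similar_mat_witD2(1,2,6,7)[OF ca w]
  have "similar_mat_wit (four_block_mat (four_block_mat a b g d) H (beside (0\<^sub>m j k) r) S)
      (four_block_mat (companion_block k ?p ?q) (?Q * H) (beside (0\<^sub>m j k) r) S)
      (four_block_mat (four_block_mat g' (- (g' * d)) (0\<^sub>m k k) (1\<^sub>m k)) (0\<^sub>m (k + k) j) (0\<^sub>m j (k + k)) (1\<^sub>m j))
      (four_block_mat ?Q (0\<^sub>m (k + k) j) (0\<^sub>m j (k + k)) (1\<^sub>m j))"
  proof (rule similar_mat_wit_four_block[OF w similar_mat_wit_refl[OF S]])
    show "H = four_block_mat g' (- (g' * d)) (0\<^sub>m k k) (1\<^sub>m k) * (?Q * H) * 1\<^sub>m j"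
      using wD H by (simp add: assoc_mult_mat[of _ "k + k" "k + k" _ "k + k" _ j, symmetric])
    have "beside (0\<^sub>m j k) r * ?Q = beside (0\<^sub>m j k) r"
      by (subst beside_times_four_block[of _ k k _ k _ k _ _ j]) (use r g d in auto)
    moreover have "1\<^sub>m j * beside (0\<^sub>m j k) r = beside (0\<^sub>m j k) r"
      by (rule left_mult_one_mat[of _ _ "k + k"]) (use r in auto)
    ultimately show "beside (0\<^sub>m j k) r = 1\<^sub>m j * beside (0\<^sub>m j k) r * ?Q" by simp
  qed (use wD ca H r S in auto)
  then have sim: "similar_mat (four_block_mat (four_block_mat a b g d) H (beside (0\<^sub>m j k) r) S)
      (four_block_mat (companion_block k ?p ?q) (?Q * H) (beside (0\<^sub>m j k) r) S)"
    unfolding similar_mat_def by blast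
  have p: "?p \<in> carrier_mat k k" using d by simp
  have q: "?q \<in> carrier_mat k k" by (rule minus_carrier_mat[OF mult_carrier_mat[OF p d]])
  show ?thesis by (rule that[OF p q mult_carrier_mat[OF wD(4) H] sim])
qed

text \<open>
  A shear of the last coordinate along the first block removes the second half of \<open>H\<close>.  It cannot disturb
  the last row, as this row vanishes on the first block.
\<close>

lemma odd_coupled_word_values:
  fixes p :: "'a::field mat"
  assumes two: "(2::'a) \<noteq> 0" and p: "p \<in> carrier_mat k k" and q: "q \<in> carrier_mat k k"
    and H: "H \<in> carrier_mat (k + k) 1" and r: "r \<in> carrier_mat 1 k" and k: "k \<ge> 1"
  shows "four_block_mat (companion_block k p q) H (beside (0\<^sub>m 1 k) r) (s \<cdot>\<^sub>m 1\<^sub>m 1) \<in> word_values (k + k + 1) 10"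
proof -
  obtain h1 h2 where h: "h1 \<in> carrier_mat k 1" "h2 \<in> carrier_mat k 1" and H_eq: "H = stack h1 h2"
    using stack_split[OF H] .
  let ?F = "stack h2 (0\<^sub>m k 1)" and ?C = "beside (0\<^sub>m 1 k) r" and ?A = "companion_block k p q"
  have cF: "?F \<in> carrier_mat (k + k) 1" and cC: "?C \<in> carrier_mat 1 (k + k)" using h r by auto
  have FC: "?A + ?F * ?C = companion_block k p (q + h2 * r)"
  proof -
    have "?F * ?C = four_block_mat (0\<^sub>m k k) (h2 * r) (0\<^sub>m k k) (0\<^sub>m k k)"
      by (subst stack_times_beside[of _ k 1 _ k _ k _ k]) (use h r in auto)
    then show ?thesis unfolding companion_block_def
      by (simp, subst add_four_block_mat[of _ k k _ k _ k]) (use p q h r in auto)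
  qed
  have CF: "?C * ?F = 0\<^sub>m 1 1"
    by (subst beside_times_stack[of _ 1 k _ k _ 1]) (use h r in auto)
  have HF: "H + ?F * (s \<cdot>\<^sub>m 1\<^sub>m 1) - companion_block k p (q + h2 * r) * ?F = stack (h1 + s \<cdot>\<^sub>m h2 - p * h2) (0\<^sub>m k 1)"
  proof -
    have "companion_block k p (q + h2 * r) * ?F = stack (p * h2) h2" unfolding companion_block_def
      by (subst four_block_times_stack[of _ k k _ k _ k _ _ 1]) (use h p q r in auto)
    moreover have "?F * (s \<cdot>\<^sub>m 1\<^sub>m 1) = s \<cdot>\<^sub>m ?F" using cF right_mult_one_mat[OF cF] by (simp add: mult_smult_distrib[of _ "k + k" 1 _ 1])
    moreover have "p * h2 \<in> carrier_mat k 1" using p h by auto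
    ultimately show ?thesis unfolding H_eq using h
      by (intro eq_matI) (auto simp: stack_index[of _ k 1 _ k] stack_def simp del: index_mult_mat(1))
  qed
  have "similar_mat (four_block_mat ?A H ?C (s \<cdot>\<^sub>m 1\<^sub>m 1))
    (four_block_mat (companion_block k p (q + h2 * r)) (stack (h1 + s \<cdot>\<^sub>m h2 - p * h2) (0\<^sub>m k 1)) ?C (s \<cdot>\<^sub>m 1\<^sub>m 1))"
    using similar_upper_shear[OF companion_block_carrier[OF p q] H cC _ cF, of "s \<cdot>\<^sub>m 1\<^sub>m 1"]
    unfolding FC HF CF by (simp add: minus_zero_mat[of _ 1 1, simplified])
  moreover obtain p' q' H' d where pq: "p' \<in> carrier_mat k k" "q' \<in> carrier_mat k k" "H' \<in> carrier_mat (k + k) 1" and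
    red: "reduces (k + k + 1) 2
      (four_block_mat (companion_block k p (q + h2 * r)) (stack (h1 + s \<cdot>\<^sub>m h2 - p * h2) (0\<^sub>m k 1)) ?C (s \<cdot>\<^sub>m 1\<^sub>m 1))
      (four_block_mat (companion_block k p' q') H' (0\<^sub>m 1 (k + k)) (d \<cdot>\<^sub>m 1\<^sub>m 1))"
    by (rule odd_triangularize[OF two p _ _ r k, of "q + h2 * r" "h1 + s \<cdot>\<^sub>m h2 - p * h2" s]) (use p q h r in auto)
  ultimately have "reduces (k + k + 1) 2 (four_block_mat ?A H ?C (s \<cdot>\<^sub>m 1\<^sub>m 1))
      (four_block_mat (companion_block k p' q') H' (0\<^sub>m 1 (k + k)) (d \<cdot>\<^sub>m 1\<^sub>m 1))"
    using reduces_similar by blast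
  from reduces_word_values[OF two this odd_triangular_word_values[OF two pq k]] show ?thesis by simp
qed

section \<open>Maximal families of independent pairs\<close>

text \<open>
  A nonscalar \<open>S\<close> moves some vector \<open>v\<close> out of its line, and a basis that begins with \<open>v\<close> and ends
  with \<open>S v\<close> has the wanted first column.  It is reached by a permutation and at most two shears.
\<close>

lemma similar_pivot:
  fixes S :: "'a::field mat"
  assumes S: "S \<in> carrier_mat j j" and j: "j \<ge> 2" and ns: "\<nexists>c. S = c \<cdot>\<^sub>m 1\<^sub>m j"
  obtains S' where "similar_mat S S'" "S' $$ (j - 1, 0) \<noteq> 0" "\<And>i. 0 < i \<Longrightarrow> i < j - 1 \<Longrightarrow> S' $$ (i, 0) = 0"
proof -
  have "\<exists>a b. a < j \<and> b < j \<and> a \<noteq> b \<and>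
    (S $$ (a, b) \<noteq> 0 \<or> S $$ (b, a) = 0 \<and> S $$ (a, b) = 0 \<and> S $$ (a, a) \<noteq> S $$ (b, b))"
  proof (rule ccontr)
    assume neg: "\<not> ?thesis"
    then have off: "S $$ (a, b) = 0" if "a < j" "b < j" "a \<noteq> b" for a b using that by blast
    have diag: "S $$ (a, a) = S $$ (0, 0)" if "a < j" for a
    proof (rule ccontr)
      assume ne: "S $$ (a, a) \<noteq> S $$ (0, 0)"
      then have "a \<noteq> 0" by metis
      moreover have "0 < j" using j by simp
      ultimately show False using ne off[of 0 a] off[of a 0] neg that by blast
    qed
    have "S = S $$ (0, 0) \<cdot>\<^sub>m 1\<^sub>m j"
    proof (rule eq_matI)
      fix i c assume "i < dim_row (S $$ (0, 0) \<cdot>\<^sub>m 1\<^sub>m j)" "c < dim_col (S $$ (0, 0) \<cdot>\<^sub>m 1\<^sub>m j)"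
      then show "S $$ (i, c) = (S $$ (0, 0) \<cdot>\<^sub>m 1\<^sub>m j) $$ (i, c)"
        using off[of i c] diag[of i] by (cases "i = c") simp_all
    qed (use S in auto)
    with ns show False by blast
  qed
  then obtain a b where ab: "a < j" "b < j" "a \<noteq> b"
    "S $$ (a, b) \<noteq> 0 \<or> S $$ (b, a) = 0 \<and> S $$ (a, b) = 0 \<and> S $$ (a, a) \<noteq> S $$ (b, b)" by blast
  define a' where "a' = transpose 0 b a"
  define f where "f = transpose 0 b \<circ> transpose (j - 1) a'"
  have a': "a' < j" "a' \<noteq> 0" "transpose 0 b a' = a" using ab j by (auto simp: a'_def transpose_def)
  have f0: "f 0 = b" and fj: "f (j - 1) = a" using a' j by (auto simp: f_def)
  have f: "bij_betw f {..<j} {..<j}"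
    unfolding f_def by (rule bij_betw_trans[of _ _ "{..<j}"]) (use a' ab j in \<open>auto simp: bij_betw_transpose_iff\<close>)
  define S1 where "S1 = mat j j (\<lambda>(i, c). S $$ (f i, f c))"
  have S1: "S1 \<in> carrier_mat (j - 1 + 1) (j - 1 + 1)" using j by (simp add: S1_def)
  have sim1: "similar_mat S S1" unfolding S1_def by (rule similar_reindex[OF S f])
  have e: "S1 $$ (j - 1, 0) = S $$ (a, b)" "S1 $$ (0, j - 1) = S $$ (b, a)"
    "S1 $$ (0, 0) = S $$ (b, b)" "S1 $$ (j - 1, j - 1) = S $$ (a, a)"
    using j f0 fj by (auto simp: S1_def)
  obtain S2 where S2: "S2 \<in> carrier_mat (j - 1 + 1) (j - 1 + 1)" "similar_mat S1 S2" "S2 $$ (j - 1, 0) \<noteq> 0"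
  proof (cases "S $$ (a, b) = 0")
    case True
    define A B C D where "A = mat (j - 1) (j - 1) (\<lambda>(i, c). S1 $$ (i, c))" and "B = mat (j - 1) 1 (\<lambda>(i, c). S1 $$ (i, j - 1 + c))"
      and "C = mat 1 (j - 1) (\<lambda>(i, c). S1 $$ (j - 1 + i, c))" and "D = mat 1 1 (\<lambda>(i, c). S1 $$ (j - 1 + i, j - 1 + c))"
    have s: "S1 = four_block_mat A B C D" unfolding A_def B_def C_def D_def by (rule four_block_split[OF S1])
    define F where "F = mat 1 (j - 1) (\<lambda>(i, c). if c = 0 then 1 else (0::'a))"
    let ?S2 = "four_block_mat (A - B * F) B (F * A + C - (F * B + D) * F) (F * B + D)"
    have "similar_mat S1 ?S2" unfolding s
      by (rule similar_lower_shear) (auto simp: A_def B_def C_def D_def F_def)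
    moreover have "?S2 $$ (j - 1, 0) = A $$ (0, 0) + C $$ (0, 0) - (B $$ (0, 0) + D $$ (0, 0))"
      using j by (simp add: A_def B_def C_def D_def F_def scalar_prod_def if_distrib[of "\<lambda>x. x * _"] cong: if_cong)
    then have "?S2 $$ (j - 1, 0) = S $$ (b, b) - S $$ (a, a)"
      using e True ab j by (simp add: A_def B_def C_def D_def)
    then have "?S2 $$ (j - 1, 0) \<noteq> 0" using True ab by (metis right_minus_eq)
    moreover have "?S2 \<in> carrier_mat (j - 1 + 1) (j - 1 + 1)"
      by (rule four_block_carrier_mat) (auto simp: A_def B_def C_def D_def F_def)
    ultimately show ?thesis using that by blast
  next
    case False
    then show ?thesis using that[of S1] S1 similar_mat_refl[OF S1] e by simp
  qed
  define A B C D where "A = mat (j - 1) (j - 1) (\<lambda>(i, c). S2 $$ (i, c))" and "B = mat (j - 1) 1 (\<lambda>(i, c). S2 $$ (i, j - 1 + c))"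
    and "C = mat 1 (j - 1) (\<lambda>(i, c). S2 $$ (j - 1 + i, c))" and "D = mat 1 1 (\<lambda>(i, c). S2 $$ (j - 1 + i, j - 1 + c))"
  have s: "S2 = four_block_mat A B C D" unfolding A_def B_def C_def D_def by (rule four_block_split[OF S2(1)])
  define F where "F = mat (j - 1) 1 (\<lambda>(i, c). if i = 0 then 0 else - S2 $$ (i, 0) / S2 $$ (j - 1, 0))"
  let ?S3 = "four_block_mat (A + F * C) (B + F * D - (A + F * C) * F) C (D - C * F)"
  have sim3: "similar_mat S2 ?S3" unfolding s
    by (rule similar_upper_shear) (auto simp: A_def B_def C_def D_def F_def)
  have "?S3 $$ (j - 1, 0) = S2 $$ (j - 1, 0)"
    using j by (simp add: A_def B_def C_def D_def F_def)
  then have "?S3 $$ (j - 1, 0) \<noteq> 0" using S2(3) by simp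
  moreover have "?S3 $$ (i, 0) = 0" if "0 < i" "i < j - 1" for i
    using that j S2(3) by (simp add: A_def B_def C_def D_def F_def scalar_prod_def)
  ultimately show ?thesis
    using that[OF similar_mat_trans[OF sim1 similar_mat_trans[OF S2(2) sim3]]] by blast
qed

text \<open>
  The span \<open>W\<close> of the first \<open>k\<close> basis vectors satisfies \<open>dim (W + A W) = 2 k\<close>, and \<open>W + A W\<close> is
  spanned by the first \<open>k\<close> and the last \<open>k\<close> basis vectors.  With this order, a further pair is taken
  from the middle by moving the two cuts by one place, without reordering the basis.
\<close>

definition paired :: "nat \<Rightarrow> nat \<Rightarrow> 'a::field mat \<Rightarrow> bool" where
  "paired n k A \<longleftrightarrow> A \<in> carrier_mat n n \<and> 2 * k \<le> n \<and>
    (\<forall>i c. k \<le> i \<longrightarrow> i < n - k \<longrightarrow> c < k \<longrightarrow> A $$ (i, c) = 0) \<and>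
    (\<exists>g'. g' \<in> carrier_mat k k \<and> mat k k (\<lambda>(i, c). A $$ (n - k + i, c)) * g' = 1\<^sub>m k)"

lemma paired_zero: "A \<in> carrier_mat n n \<Longrightarrow> paired n 0 A"
  unfolding paired_def by (auto intro!: exI[of _ "1\<^sub>m 0"] eq_matI)

text \<open>
  The images of the middle basis vectors, and of the last \<open>k\<close> basis vectors, modulo \<open>W + A W\<close>.
\<close>

definition middle :: "nat \<Rightarrow> nat \<Rightarrow> 'a mat \<Rightarrow> 'a mat" where
  "middle n k A = mat (n - 2 * k) (n - 2 * k) (\<lambda>(i, c). A $$ (k + i, k + c))"

definition middle_right :: "nat \<Rightarrow> nat \<Rightarrow> 'a mat \<Rightarrow> 'a mat" where
  "middle_right n k A = mat (n - 2 * k) k (\<lambda>(i, c). A $$ (k + i, n - k + c))"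

text \<open>
  The middle basis vectors may be replaced by another basis \<open>P\<close> of the quotient and shifted by
  combinations \<open>F\<close> of the last basis vectors.
\<close>

lemma paired_similar:
  fixes A :: "'a::field mat"
  assumes A: "paired n k A" and j: "n - 2 * k = j"
    and P: "P \<in> carrier_mat j j" and Q: "Q \<in> carrier_mat j j" and QP: "Q * P = 1\<^sub>m j"
    and F: "F \<in> carrier_mat k j"
  obtains A' where "similar_mat A A'" "paired n k A'"
    "middle n k A' = Q * (middle n k A - middle_right n k A * F) * P"
proof -
  have Ac: "A \<in> carrier_mat n n" and n: "n = k + (j + k)" using A j by (auto simp: paired_def)
  then have Ac': "A \<in> carrier_mat (k + (j + k)) (k + (j + k))" by simp
  define a B C D where "a = mat k k (\<lambda>(i, c). A $$ (i, c))" and "B = mat k (j + k) (\<lambda>(i, c). A $$ (i, k + c))"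
    and "C = mat (j + k) k (\<lambda>(i, c). A $$ (k + i, c))" and "D = mat (j + k) (j + k) (\<lambda>(i, c). A $$ (k + i, k + c))"
  have c: "a \<in> carrier_mat k k" "B \<in> carrier_mat k (j + k)" "C \<in> carrier_mat (j + k) k" "D \<in> carrier_mat (j + k) (j + k)"
    by (auto simp: a_def B_def C_def D_def)
  have A_eq: "A = four_block_mat a B C D" unfolding a_def B_def C_def D_def by (rule four_block_split[OF Ac'])
  define S T U V where "S = mat j j (\<lambda>(i, c). D $$ (i, c))" and "T = mat j k (\<lambda>(i, c). D $$ (i, j + c))"
    and "U = mat k j (\<lambda>(i, c). D $$ (j + i, c))" and "V = mat k k (\<lambda>(i, c). D $$ (j + i, j + c))"
  have c': "S \<in> carrier_mat j j" "T \<in> carrier_mat j k" "U \<in> carrier_mat k j" "V \<in> carrier_mat k k"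
    by (auto simp: S_def T_def U_def V_def)
  have D_eq: "D = four_block_mat S T U V" unfolding S_def T_def U_def V_def by (rule four_block_split[OF c(4)])
  have S: "S = middle n k A" and T: "T = middle_right n k A"
    unfolding middle_def middle_right_def S_def T_def D_def using j n by (auto intro!: eq_matI simp: ac_simps)
  define g where "g = mat k k (\<lambda>(i, c). A $$ (n - k + i, c))"
  have g: "g \<in> carrier_mat k k" by (simp add: g_def)
  have C: "C = stack (0\<^sub>m j k) g"
  proof (rule eq_matI)
    fix i c assume "i < dim_row (stack (0\<^sub>m j k) g)" "c < dim_col (stack (0\<^sub>m j k) g)"
    then have ic: "i < j + k" "c < k" by (auto simp: g_def)
    show "C $$ (i, c) = stack (0\<^sub>m j k) g $$ (i, c)"
    proof (cases "i < j")
      case True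
      then have "A $$ (k + i, c) = 0" using A ic n by (auto simp: paired_def)
      then show ?thesis using ic True by (simp add: C_def stack_index[OF zero_carrier_mat g])
    next
      case False
      then have eq: "n - k + (i - j) = k + i" using n by simp
      have "stack (0\<^sub>m j k) g $$ (i, c) = g $$ (i - j, c)"
        using ic False by (simp add: stack_index[OF zero_carrier_mat g])
      also have "\<dots> = A $$ (n - k + (i - j), c)" using ic False by (auto simp: g_def)
      finally show ?thesis unfolding eq using ic by (simp add: C_def)
    qed
  qed (auto simp: C_def g_def)
  have PQ: "P * Q = 1\<^sub>m j" by (rule mat_mult_left_right_inverse[OF Q P QP])
  \<comment> \<open>The basis change \<open>X\<close> acts on the last \<open>j + k\<close> coordinates only, and its inverse \<open>Y\<close> fixes the
  vectors whose middle part is zero.  Hence the first \<open>k\<close> columns do not change.\<close>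
  define X where "X = four_block_mat P (0\<^sub>m j k) (- (F * P)) (1\<^sub>m k)"
  define Y where "Y = four_block_mat Q (0\<^sub>m j k) F (1\<^sub>m k)"
  have X: "X \<in> carrier_mat (j + k) (j + k)" and Y: "Y \<in> carrier_mat (j + k) (j + k)" using P Q by (auto simp: X_def Y_def)
  have FP: "F * P \<in> carrier_mat k j" using F P by auto
  have YX: "Y * X = 1\<^sub>m (j + k)"
  proof -
    have "F * P + - (F * P) = 0\<^sub>m k j" by (rule eq_matI) (use carrier_matD[OF FP] in \<open>auto simp del: index_mult_mat(1)\<close>)
    then show ?thesis unfolding X_def Y_def
      by (subst mult_four_block_mat[of _ j j _ k _ k _ _ j _ k]) (use P Q F FP QP in auto)
  qed
  have XY: "X * Y = 1\<^sub>m (j + k)" by (rule mat_mult_left_right_inverse[OF Y X YX])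
  define D' where "D' = Y * D * X"
  have D': "D' \<in> carrier_mat (j + k) (j + k)" using Y c(4) X by (auto simp: D'_def)
  have YC: "Y * C = C" unfolding C Y_def
    by (subst four_block_times_stack[of _ j j _ k _ k _ _ k]) (use Q F g in auto)
  have wD: "similar_mat_wit D' D Y X" using D' c(4) X Y XY YX by (intro similar_mat_witI) (auto simp: D'_def)
  have wA: "similar_mat_wit (four_block_mat a (B * X) C D') (four_block_mat a B C D)
    (four_block_mat (1\<^sub>m k) (0\<^sub>m k (j + k)) (0\<^sub>m (j + k) k) Y) (four_block_mat (1\<^sub>m k) (0\<^sub>m k (j + k)) (0\<^sub>m (j + k) k) X)"
    by (rule similar_mat_wit_four_block[OF similar_mat_wit_refl[OF c(1)] wD])
      (use c D' YC in \<open>auto simp: left_mult_one_mat[OF c(2)] right_mult_one_mat[OF c(3)]\<close>)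
  let ?A' = "four_block_mat a (B * X) C D'"
  have sim: "similar_mat A ?A'" unfolding A_eq using similar_mat_wit_sym[OF wA] unfolding similar_mat_def by blast
  have A'c: "?A' \<in> carrier_mat n n" using c D' n by auto
  have first: "?A' $$ (i, c) = A $$ (i, c)" if "i < n" "c < k" "k \<le> i" for i c
    using that c D' n by (simp add: C_def)
  have "mat k k (\<lambda>(i, c). ?A' $$ (n - k + i, c)) = mat k k (\<lambda>(i, c). A $$ (n - k + i, c))"
    using n by (intro eq_matI) (auto simp del: index_mat_four_block simp: first)
  then have paired: "paired n k ?A'"
    using A A'c first unfolding paired_def by (auto simp del: index_mat_four_block)
  obtain X2 X3 X4 where "X4 \<in> carrier_mat k k" "D' = four_block_mat (Q * (S - T * F) * P) X2 X3 X4"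
  proof -
    have YD: "Y * D = four_block_mat (Q * S) (Q * T) (F * S + U) (F * T + V)"
      unfolding Y_def D_eq by (subst mult_four_block_mat[of _ j j _ k _ k _ _ j _ k]) (use Q F c' in auto)
    have "Q * (S - T * F) * P = Q * S * P - Q * (T * F) * P"
      using Q P c' F by (simp add: mult_minus_distrib_mat[of _ j j _ j] minus_mult_distrib_mat[of _ j j _ _ j])
    also have "Q * (T * F) * P = (Q * T) * (F * P)"
      using Q P c' F by (simp add: assoc_mult_mat[of _ j j _ k _ j] assoc_mult_mat[of _ j k _ j _ j] assoc_mult_mat[of _ j j _ j _ j])
    finally have e: "Q * S * P + (Q * T) * - (F * P) = Q * (S - T * F) * P"
    proof -
      have QT: "Q * T \<in> carrier_mat j k" and QSP: "Q * S * P \<in> carrier_mat j j"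
        and m: "(Q * T) * (F * P) \<in> carrier_mat j j" using Q P c' FP by auto
      assume "Q * (S - T * F) * P = Q * S * P - (Q * T) * (F * P)"
      moreover have "(Q * T) * - (F * P) = - ((Q * T) * (F * P))"
        by (rule uminus_mult_right_mat) (use QT FP c' F in auto)
      ultimately show ?thesis using minus_add_uminus_mat[OF QSP m] by simp
    qed
    have c'': "Q * S \<in> carrier_mat j j" "Q * T \<in> carrier_mat j k" "F * S + U \<in> carrier_mat k j" "F * T + V \<in> carrier_mat k k"
      using Q F c' by auto
    have m: "- (F * P) \<in> carrier_mat k j" using FP by simp
    have "(F * S + U) * 0\<^sub>m j k + (F * T + V) * 1\<^sub>m k \<in> carrier_mat k k" using c'' by auto
    then show ?thesis
      using that mult_four_block_mat[OF c'' P zero_carrier_mat m one_carrier_mat] unfolding D'_def YD X_def e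
      by blast
  qed
  then have "D' $$ (i, c) = (Q * (S - T * F) * P) $$ (i, c)" if "i < j" "c < j" for i c
    using that Q P F c' by simp
  then have "middle n k ?A' = Q * (S - T * F) * P"
    using c D' n P Q j by (intro eq_matI) (auto simp: middle_def simp del: index_mult_mat(1))
  then show ?thesis using that sim paired unfolding S T by blast
qed

text \<open>
  With the pivot of the middle block, the new lower left block has the rows \<open>(0, s)\<close> and \<open>(g, x)\<close>, where
  \<open>g\<close> and \<open>s\<close> are invertible.
\<close>

lemma paired_Suc:
  fixes A :: "'a::field mat"
  assumes A: "paired n k A" and j: "n - 2 * k = j" "j \<ge> 2"
    and piv: "middle n k A $$ (j - 1, 0) \<noteq> 0" "\<And>i. 0 < i \<Longrightarrow> i < j - 1 \<Longrightarrow> middle n k A $$ (i, 0) = 0"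
  shows "paired n (Suc k) A"
proof -
  have n: "n = k + j + k" and Ac: "A \<in> carrier_mat n n" using A j by (auto simp: paired_def)
  obtain g' where g': "g' \<in> carrier_mat k k" "mat k k (\<lambda>(i, c). A $$ (n - k + i, c)) * g' = 1\<^sub>m k"
    using A by (auto simp: paired_def)
  define g where "g = mat k k (\<lambda>(i, c). A $$ (n - k + i, c))"
  have g: "g \<in> carrier_mat k k" by (simp add: g_def)
  have gg: "g * g' = 1\<^sub>m k" using g'(2) by (simp add: g_def)
  define s where "s = A $$ (n - Suc k, k)"
  have s: "s \<noteq> 0"
    using piv(1) j n by (simp add: middle_def s_def add.commute)
  define x where "x = mat k 1 (\<lambda>(i, c). A $$ (n - k + i, k))"
  have x: "x \<in> carrier_mat k 1" by (simp add: x_def)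
  define N where "N = mat (1 + k) (k + 1) (\<lambda>(i, c). A $$ (n - Suc k + i, c))"
  have N: "N = four_block_mat (0\<^sub>m 1 k) (s \<cdot>\<^sub>m 1\<^sub>m 1) g x"
  proof (rule eq_matI)
    fix i c assume "i < dim_row (four_block_mat (0\<^sub>m 1 k) (s \<cdot>\<^sub>m 1\<^sub>m 1) g x)" "c < dim_col (four_block_mat (0\<^sub>m 1 k) (s \<cdot>\<^sub>m 1\<^sub>m 1) g x)"
    then have ic: "i < 1 + k" "c < k + 1" by (auto simp: x_def)
    show "N $$ (i, c) = four_block_mat (0\<^sub>m 1 k) (s \<cdot>\<^sub>m 1\<^sub>m 1) g x $$ (i, c)"
    proof (cases "i = 0")
      case True
      have "A $$ (n - Suc k, c) = 0" if "c < k" using A that n j by (auto simp: paired_def)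
      then show ?thesis using True ic x by (auto simp: N_def s_def less_Suc_eq)
    next
      case False
      then have "n - Suc k + i = n - k + (i - 1)" using n j by auto
      then show ?thesis using False ic x by (auto simp: N_def g_def x_def less_Suc_eq)
    qed
  qed (auto simp: N_def x_def)
  define N' where "N' = four_block_mat ((- (1 / s)) \<cdot>\<^sub>m (g' * x)) g' ((1 / s) \<cdot>\<^sub>m 1\<^sub>m 1) (0\<^sub>m 1 k)"
  have gx: "g' * x \<in> carrier_mat k 1" using g' x by auto
  have "N * N' = 1\<^sub>m (1 + k)"
  proof -
    have "g * (g' * x) = x"
      using gg g'(1) g x by (simp add: assoc_mult_mat[of g k k g' k x 1, symmetric])
    then have e3: "g * ((- (1 / s)) \<cdot>\<^sub>m (g' * x)) + x * ((1 / s) \<cdot>\<^sub>m 1\<^sub>m 1) = 0\<^sub>m k 1"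
      using g gx x by (auto intro!: eq_matI simp: mult_smult_distrib[of _ k k _ 1] mult_smult_distrib[of _ k 1 _ 1] simp del: index_mult_mat(1))
    have c: "(- (1 / s)) \<cdot>\<^sub>m (g' * x) \<in> carrier_mat k 1" "s \<cdot>\<^sub>m 1\<^sub>m 1 \<in> carrier_mat 1 1"
      "(1 / s) \<cdot>\<^sub>m 1\<^sub>m 1 \<in> carrier_mat 1 1" using gx by auto
    have "(s \<cdot>\<^sub>m 1\<^sub>m 1) * ((1 / s) \<cdot>\<^sub>m 1\<^sub>m 1) = (1\<^sub>m 1 :: 'a mat)"
      using s by (auto intro!: eq_matI)
    then have e1: "0\<^sub>m 1 k * ((- (1 / s)) \<cdot>\<^sub>m (g' * x)) + (s \<cdot>\<^sub>m 1\<^sub>m 1) * ((1 / s) \<cdot>\<^sub>m 1\<^sub>m 1) = (1\<^sub>m 1 :: 'a mat)"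
      unfolding left_mult_zero_mat[OF c(1)] by simp
    have e2: "0\<^sub>m 1 k * g' + (s \<cdot>\<^sub>m 1\<^sub>m 1) * 0\<^sub>m 1 k = 0\<^sub>m 1 k" using g'(1) by simp
    have e4: "g * g' + x * 0\<^sub>m 1 k = 1\<^sub>m k" using gg x by simp
    show ?thesis unfolding N N'_def
      unfolding mult_four_block_mat[OF zero_carrier_mat c(2) g x c(1) g'(1) c(3) zero_carrier_mat] e1 e2 e3 e4
      by (rule four_block_one_mat)
  qed
  moreover have "N' \<in> carrier_mat (Suc k) (Suc k)" using gx g'(1) by (intro carrier_matI) (auto simp: N'_def)
  moreover have "mat (Suc k) (Suc k) (\<lambda>(i, c). A $$ (n - Suc k + i, c)) = N" by (simp add: N_def)
  moreover have "A $$ (i, c) = 0" if "Suc k \<le> i" "i < n - Suc k" "c < Suc k" for i c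
  proof (cases "c = k")
    case True
    have "middle n k A $$ (i - k, 0) = 0" using piv(2)[of "i - k"] that n by auto
    then show ?thesis using that n True j by (simp add: middle_def)
  next
    case False
    then show ?thesis using A that by (auto simp: paired_def)
  qed
  ultimately show ?thesis unfolding paired_def using Ac j n by auto
qed

lemma paired_extend:
  fixes A :: "'a::field mat"
  assumes A: "paired n k A" and j: "n - 2 * k \<ge> 2"
    and F: "F \<in> carrier_mat k (n - 2 * k)"
    and ns: "\<nexists>c. middle n k A - middle_right n k A * F = c \<cdot>\<^sub>m 1\<^sub>m (n - 2 * k)"
  shows "\<exists>A'. similar_mat A A' \<and> paired n (Suc k) A'"
proof -
  let ?j = "n - 2 * k"
  let ?S = "middle n k A - middle_right n k A * F"
  have S: "?S \<in> carrier_mat ?j ?j" using F by (auto simp: middle_def middle_right_def)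
  obtain S' where S': "similar_mat ?S S'" "S' $$ (?j - 1, 0) \<noteq> 0" "\<And>i. 0 < i \<Longrightarrow> i < ?j - 1 \<Longrightarrow> S' $$ (i, 0) = 0"
    using similar_pivot[OF S j ns] by blast
  obtain P Q where w: "similar_mat_wit S' ?S Q P"
    using similar_mat_sym[OF S'(1)] unfolding similar_mat_def by blast
  have "S' \<in> carrier_mat ?j ?j" using similar_mat_carrier(2)[OF S'(1) S] .
  note wD = similar_mat_witD2[OF this w]
  obtain A' where A': "similar_mat A A'" "paired n k A'" "middle n k A' = Q * ?S * P"
    by (rule paired_similar[OF A refl wD(7,6,1) F])
  have "paired n (Suc k) A'"
    by (rule paired_Suc[OF A'(2) refl j]) (use S' in \<open>auto simp: A'(3) wD(3)[symmetric]\<close>)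
  then show ?thesis using A' by blast
qed

lemma paired_split:
  fixes A :: "'a::field mat"
  assumes A: "paired n k A" and j: "n - 2 * k = j"
  obtains p q H where "p \<in> carrier_mat k k" "q \<in> carrier_mat k k" "H \<in> carrier_mat (k + k) j"
    "similar_mat A (four_block_mat (companion_block k p q) H (beside (0\<^sub>m j k) (middle_right n k A)) (middle n k A))"
proof -
  have n: "n = k + k + j" and Ac: "A \<in> carrier_mat n n" using A j by (auto simp: paired_def)
  define f where "f i = (if i < k then i else if i < k + k then i + j else i - k)" for i
  have f: "bij_betw f {..<n} {..<n}"
  proof -
    have "inj_on f {..<n}" unfolding inj_on_def f_def using n by auto
    moreover have "f ` {..<n} \<subseteq> {..<n}" using n by (auto simp: f_def)
    ultimately show ?thesis by (simp add: bij_betw_def endo_inj_surj)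
  qed
  define B where "B = mat n n (\<lambda>(i, c). A $$ (f i, f c))"
  have B: "B \<in> carrier_mat (k + k + j) (k + k + j)" using n by (simp add: B_def)
  have AB: "similar_mat A B" unfolding B_def by (rule similar_reindex[OF Ac f])
  define G where "G = mat (k + k) (k + k) (\<lambda>(i, c). B $$ (i, c))"
  define H where "H = mat (k + k) j (\<lambda>(i, c). B $$ (i, k + k + c))"
  have G: "G \<in> carrier_mat (k + k) (k + k)" and H: "H \<in> carrier_mat (k + k) j" by (auto simp: G_def H_def)
  have 1: "mat j (k + k) (\<lambda>(i, c). B $$ (k + k + i, c)) = beside (0\<^sub>m j k) (middle_right n k A)" (is "?K = _")
  proof (rule eq_matI)
    fix i c assume "i < dim_row (beside (0\<^sub>m j k) (middle_right n k A))" "c < dim_col (beside (0\<^sub>m j k) (middle_right n k A))"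
    then have ic: "i < j" "c < k + k" by (auto simp: middle_right_def)
    have mr: "middle_right n k A \<in> carrier_mat j k" using j by (simp add: middle_right_def)
    have "A $$ (k + i, c) = 0" if "c < k" using A that ic n by (auto simp: paired_def)
    moreover have "k + k + i - k = k + i" "n - k + (c - k) = c + j" if "\<not> c < k" using that n by auto
    ultimately show "?K $$ (i, c) = beside (0\<^sub>m j k) (middle_right n k A) $$ (i, c)"
      unfolding beside_index[OF zero_carrier_mat mr ic] using ic n j by (auto simp: B_def f_def middle_right_def ac_simps)
  qed (auto simp: middle_right_def j)
  have 2: "mat j j (\<lambda>(i, c). B $$ (k + k + i, k + k + c)) = middle n k A"
    by (rule eq_matI) (use n j in \<open>auto simp: B_def f_def middle_def\<close>)
  have Bs: "B = four_block_mat G H (beside (0\<^sub>m j k) (middle_right n k A)) (middle n k A)"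
    using four_block_split[OF B] unfolding 1 2 G_def H_def .
  obtain g' where g': "g' \<in> carrier_mat k k" "mat k k (\<lambda>(i, c). A $$ (n - k + i, c)) * g' = 1\<^sub>m k"
    using A by (auto simp: paired_def)
  have 3: "mat k k (\<lambda>(i, c). G $$ (k + i, c)) = mat k k (\<lambda>(i, c). A $$ (n - k + i, c))"
    by (rule eq_matI) (use n in \<open>auto simp: G_def B_def f_def add.commute add.left_commute\<close>)
  have mr: "middle_right n k A \<in> carrier_mat j k" and m: "middle n k A \<in> carrier_mat j j"
    using j by (simp_all add: middle_right_def middle_def)
  define Ga Gb Gd where "Ga = mat k k (\<lambda>(i, c). G $$ (i, c))" and "Gb = mat k k (\<lambda>(i, c). G $$ (i, k + c))"
    and "Gd = mat k k (\<lambda>(i, c). G $$ (k + i, k + c))"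
  let ?g = "mat k k (\<lambda>(i, c). A $$ (n - k + i, c))"
  have Gs: "G = four_block_mat Ga Gb ?g Gd"
    unfolding 3[symmetric] Ga_def Gb_def Gd_def by (rule four_block_split[OF G])
  have Gc: "Ga \<in> carrier_mat k k" "Gb \<in> carrier_mat k k" "?g \<in> carrier_mat k k" "Gd \<in> carrier_mat k k"
    by (auto simp: Ga_def Gb_def Gd_def)
  obtain p q H' where pq: "p \<in> carrier_mat k k" "q \<in> carrier_mat k k" "H' \<in> carrier_mat (k + k) j"
    and sim: "similar_mat (four_block_mat (four_block_mat Ga Gb ?g Gd) H (beside (0\<^sub>m j k) (middle_right n k A)) (middle n k A))
      (four_block_mat (companion_block k p q) H' (beside (0\<^sub>m j k) (middle_right n k A)) (middle n k A))"
    by (rule similar_coupled_companion_block[OF Gc g' H mr m])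
  show ?thesis
    by (rule that[OF pq similar_mat_trans[OF AB]]) (use sim in \<open>simp only: Bs Gs[symmetric]\<close>)
qed

text \<open>
  If \<open>T\<close> had a nonzero entry in row \<open>i\<close>, then a matrix unit \<open>F\<close> would move it to a place outside
  the diagonal of \<open>S - T F\<close>.
\<close>

lemma zero_and_scalar_if_all_scalar:
  assumes "j \<ge> 2" "T \<in> carrier_mat j k" "S \<in> carrier_mat j j"
    and all: "\<And>F. F \<in> carrier_mat k j \<Longrightarrow> \<exists>c. S - T * F = c \<cdot>\<^sub>m (1\<^sub>m j :: 'a::field mat)"
  shows "T = 0\<^sub>m j k" "\<exists>c. S = c \<cdot>\<^sub>m 1\<^sub>m j"
proof -
  have "S - T * 0\<^sub>m k j = S" using assms(2,3) by (simp add: right_mult_zero_mat[of _ j k])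
  then show S: "\<exists>c. S = c \<cdot>\<^sub>m 1\<^sub>m j" using all[of "0\<^sub>m k j"] by simp
  show "T = 0\<^sub>m j k"
  proof (rule eq_matI)
    fix i c assume "i < dim_row (0\<^sub>m j k :: 'a mat)" "c < dim_col (0\<^sub>m j k :: 'a mat)"
    then have ic: "i < j" "c < k" by auto
    obtain l where l: "l < j" "l \<noteq> i" using assms(1) by (metis One_nat_def Suc_1 Suc_le_lessD less_trans zero_less_one not_less_eq zero_less_Suc less_Suc_eq)
    define F where "F = mat k j (\<lambda>(a, b). if a = c \<and> b = l then 1 else (0::'a))"
    have "(T * F) $$ (i, l) = T $$ (i, c)"
      using assms(2) ic l by (simp add: F_def scalar_prod_def if_distrib[of "\<lambda>x. _ * x"] cong: if_cong)
    moreover obtain d where "S - T * F = d \<cdot>\<^sub>m 1\<^sub>m j" using all[of F] by (auto simp: F_def)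
    then have "(S - T * F) $$ (i, l) = 0" using ic l by simp
    moreover have "S $$ (i, l) = 0" using S ic l by auto
    moreover have "(S - T * F) $$ (i, l) = S $$ (i, l) - (T * F) $$ (i, l)"
      using ic l assms by (intro index_minus_mat) (auto simp: F_def)
    ultimately show "T $$ (i, c) = 0\<^sub>m j k $$ (i, c)" using ic by simp
  qed (use assms in auto)
qed

text \<open>
  Take \<open>k\<close> maximal.  If at least two middle vectors remain, maximality makes \<open>middle - middle_right F\<close>
  scalar for every \<open>F\<close>; so \<open>middle_right\<close> vanishes, and the matrix is block triangular with a
  companion block and a scalar.
\<close>

lemma word_values_nonscalar:
  fixes A :: "'a::field mat"
  assumes two: "(2::'a) \<noteq> 0" and A: "A \<in> carrier_mat n n" and n: "n \<ge> 2" and ns: "\<nexists>c. A = c \<cdot>\<^sub>m 1\<^sub>m n"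
    and L: "n \<le> 2 ^ L"
  shows "A \<in> word_values n (4 + 3 * L)"
proof -
  let ?R = "\<lambda>k. \<exists>A'. similar_mat A A' \<and> paired n k A'"
  have R1: "?R 1"
  proof -
    have "middle n 0 A - middle_right n 0 A * 0\<^sub>m 0 n = A"
      by (rule eq_matI) (use A in \<open>auto simp: middle_def middle_right_def scalar_prod_def\<close>)
    then show ?thesis using paired_extend[OF paired_zero[OF A], of "0\<^sub>m 0 n"] n ns by simp
  qed
  have bound: "k \<le> n" if "?R k" for k using that by (auto simp: paired_def)
  define k where "k = (GREATEST k. ?R k)"
  have Rk: "?R k" unfolding k_def by (rule GreatestI_nat[of ?R, OF R1 bound])
  have k: "k \<ge> 1" unfolding k_def by (rule Greatest_le_nat[of ?R, OF R1 bound])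
  have max: "\<not> ?R (Suc k)" using Greatest_le_nat[of ?R "Suc k", OF _ bound] unfolding k_def by auto
  obtain A' where A': "similar_mat A A'" "paired n k A'" using Rk by blast
  define j where "j = n - 2 * k"
  have nj: "n = k + k + j" using A'(2) by (auto simp: paired_def j_def)
  obtain p q H where pq: "p \<in> carrier_mat k k" "q \<in> carrier_mat k k" "H \<in> carrier_mat (k + k) j"
    and sim: "similar_mat A' (four_block_mat (companion_block k p q) H (beside (0\<^sub>m j k) (middle_right n k A')) (middle n k A'))"
    by (rule paired_split[OF A'(2) j_def[symmetric]])
  have mr: "middle_right n k A' \<in> carrier_mat j k" and m: "middle n k A' \<in> carrier_mat j j"
    by (simp_all add: middle_right_def middle_def j_def)
  note simA = similar_mat_trans[OF A'(1) sim]
  have "1 \<le> L" using n L by (cases L) auto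
  consider "j = 0" | "j = 1" | "j \<ge> 2" by linarith
  then show ?thesis
  proof cases
    case 1
    have "four_block_mat (companion_block k p q) H (beside (0\<^sub>m j k) (middle_right n k A')) (middle n k A') = companion_block k p q"
      by (rule four_block_empty[of _ "k + k"]) (use pq m 1 in auto)
    then have "A \<in> word_values n 5"
      using word_values_similar[OF two companion_block_word_values[OF two pq(1,2)]] simA nj 1 by simp
    then show ?thesis using word_values_mono[OF two, of 5 "4 + 3 * L"] \<open>1 \<le> L\<close> by auto
  next
    case 2
    then have "n \<ge> 3" using nj k by simp
    then have "2 \<le> L" using L by (cases L; cases "L - 1") auto
    have "middle n k A' = (middle n k A' $$ (0, 0)) \<cdot>\<^sub>m 1\<^sub>m 1"
      by (rule eq_matI) (use m 2 in auto)
    then have "A \<in> word_values n 10"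
      using word_values_similar[OF two odd_coupled_word_values[OF two pq(1,2) _ _ k, of H "middle_right n k A'" "middle n k A' $$ (0, 0)"]]
        simA pq(3) mr nj 2 by auto
    then show ?thesis using word_values_mono[OF two, of 10 "4 + 3 * L"] \<open>2 \<le> L\<close> by auto
  next
    case 3
    then have "n \<ge> 4" using nj k by simp
    then have "2 \<le> L" using L by (cases L; cases "L - 1") auto
    have "\<exists>c. middle n k A' - middle_right n k A' * F = c \<cdot>\<^sub>m 1\<^sub>m j" if "F \<in> carrier_mat k j" for F
      using paired_extend[OF A'(2), of F] that 3 max similar_mat_trans[OF A'(1)] unfolding j_def by blast
    from zero_and_scalar_if_all_scalar[OF 3 mr m this]
    obtain t where T: "middle_right n k A' = 0\<^sub>m j k" and S: "middle n k A' = t \<cdot>\<^sub>m 1\<^sub>m j" by blast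
    have z: "beside (0\<^sub>m j k) (0\<^sub>m j k) = (0\<^sub>m j (k + k) :: 'a mat)"
      by (rule eq_matI) (auto simp: beside_index[of _ j k _ k])
    have "k + k + j \<le> 2 ^ (L - 1 + 1) * k" using L nj k \<open>2 \<le> L\<close>
      by (metis One_nat_def Suc_leD Suc_pred' add.commute le_trans mult_le_mono2 nat_mult_1_right numeral_2_eq_2 plus_1_eq_Suc le_add_diff_inverse2)
    from companion_block_plus_scalar_word_values[OF two k this pq, of t]
    have "A \<in> word_values n (2 * (L - 1) + 8)"
      using word_values_similar[OF two _ simA[unfolded T S z]] unfolding nj by simp
    moreover have "2 * (L - 1) + 8 \<le> 4 + 3 * L" using \<open>2 \<le> L\<close> by arith
    ultimately show ?thesis using word_values_mono[OF two] by blast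
  qed
qed

section \<open>Products with an idempotent and the rank of the distance to a scalar\<close>

lemma conjugate_anticommutator:
  fixes f :: "'a::field mat"
  assumes "f \<in> carrier_mat n n" "C \<in> carrier_mat n n" "e \<in> carrier_mat n n"
  shows "f * (C * e + e * C) * f = f * C * (e * f) + (f * e) * (C * f)"
  using assms by (simp add: mult_add_distrib_mat[of _ n n _ n] add_mult_distrib_mat[of _ n n _ _ n] assoc_mult_mat[of _ n n _ n _ n])

lemma conjugate_smult:
  fixes f :: "'a::field mat"
  assumes "f \<in> carrier_mat n n" "X \<in> carrier_mat n n"
  shows "f * (c \<cdot>\<^sub>m X) * f = c \<cdot>\<^sub>m (f * X * f)"
  using assms by (simp add: mult_smult_distrib[of _ n n _ n] mult_smult_assoc_mat[of _ n n _ n])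

lemma peirce_zero_component:
  fixes C e :: "'a::field mat"
  assumes C: "C \<in> carrier_mat n n" and e: "e \<in> carrier_mat n n" "e * e = e"
  shows "(1\<^sub>m n - e) * jordan_product C e * (1\<^sub>m n - e) = 0\<^sub>m n n"
proof -
  let ?f = "1\<^sub>m n - e"
  have f: "?f \<in> carrier_mat n n" using e by simp
  have fe: "?f * e = 0\<^sub>m n n" and ef: "e * ?f = 0\<^sub>m n n"
    by (rule eq_matI, use e in \<open>auto simp: minus_mult_distrib_mat[of _ n n _ _ n] mult_minus_distrib_mat[of _ n n _ n] simp del: index_mult_mat(1)\<close>)+
  have "?f * (C * e + e * C) * ?f = ?f * C * (e * ?f) + (?f * e) * (C * ?f)"
    by (rule conjugate_anticommutator[OF f C e(1)])
  also have "\<dots> = 0\<^sub>m n n" unfolding fe ef using C f e(1)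
    by (simp add: right_mult_zero_mat[of _ n n] left_mult_zero_mat[of _ n n])
  finally have "?f * (C * e + e * C) * ?f = 0\<^sub>m n n" .
  then show ?thesis unfolding jordan_product_def
    using conjugate_smult[OF f, of "C * e + e * C"] C e(1) by simp
qed

text \<open>
  The factor \<open>2 - e\<close> on both sides doubles the off-diagonal blocks and keeps the first diagonal
  block; the second diagonal block of \<open>C\<close> is lost in the product and has to be added.
\<close>

lemma peirce_reconstruction:
  fixes C e :: "'a::field mat"
  assumes two: "(2::'a) \<noteq> 0" and C: "C \<in> carrier_mat n n" and e: "e \<in> carrier_mat n n" "e * e = e"
  shows "C = (2 \<cdot>\<^sub>m 1\<^sub>m n - e) * jordan_product C e * (2 \<cdot>\<^sub>m 1\<^sub>m n - e) + (1\<^sub>m n - e) * C * (1\<^sub>m n - e)"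
proof -
  let ?f = "1\<^sub>m n - e" and ?w = "2 \<cdot>\<^sub>m 1\<^sub>m n - e"
  have w: "?w \<in> carrier_mat n n" and f: "?f \<in> carrier_mat n n" using e by simp_all
  have we: "?w * e = e" and ew: "e * ?w = e"
    by (rule eq_matI, use e in \<open>auto simp: minus_mult_distrib_mat[of _ n n _ _ n] mult_minus_distrib_mat[of _ n n _ n]
      mult_smult_distrib[of _ n n _ n] mult_smult_assoc_mat[of _ n n _ n] simp del: index_mult_mat(1)\<close>)+
  have "?w * (C * e + e * C) * ?w = ?w * C * (e * ?w) + (?w * e) * (C * ?w)"
    by (rule conjugate_anticommutator[OF w C e(1)])
  also have "\<dots> = (2 \<cdot>\<^sub>m C - e * C) * e + e * (2 \<cdot>\<^sub>m C - C * e)" unfolding we ew using C e(1)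
    by (simp add: minus_mult_distrib_mat[of _ n n _ _ n] mult_minus_distrib_mat[of _ n n _ n]
      mult_smult_distrib[of _ n n _ n] mult_smult_assoc_mat[of _ n n _ n])
  also have "\<dots> = 2 \<cdot>\<^sub>m (C * e + e * C - e * C * e)" using C e(1)
    by (intro eq_matI) (auto simp: minus_mult_distrib_mat[of _ n n _ _ n] mult_minus_distrib_mat[of _ n n _ n]
      mult_smult_distrib[of _ n n _ n] mult_smult_assoc_mat[of _ n n _ n] assoc_mult_mat[of _ n n _ n _ n] algebra_simps simp del: index_mult_mat(1))
  finally have 1: "?w * jordan_product C e * ?w = C * e + e * C - e * C * e"
    unfolding jordan_product_def
    using conjugate_smult[OF w, of "C * e + e * C" "1 / 2"] C e(1) two by (simp add: smult_smult_mat)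
  have 2: "?f * C * ?f = C - e * C - (C * e - e * C * e)"
    using C e(1) by (simp add: minus_mult_distrib_mat[of _ n n _ _ n] mult_minus_distrib_mat[of _ n n _ n])
  show ?thesis unfolding 1 2
    by (rule eq_matI) (use C e(1) in \<open>auto simp del: index_mult_mat(1)\<close>)
qed

definition rank_le :: "nat \<Rightarrow> nat \<Rightarrow> 'a::field mat \<Rightarrow> bool" where
  "rank_le n r M \<longleftrightarrow> (\<exists>X Y. X \<in> carrier_mat n r \<and> Y \<in> carrier_mat r n \<and> M = X * Y)"

lemma rank_le_add:
  assumes "rank_le n r M" "rank_le n s N"
  shows "rank_le n (r + s) (M + N)"
proof -
  from assms obtain X Y U V where c: "X \<in> carrier_mat n r" "Y \<in> carrier_mat r n" "U \<in> carrier_mat n s" "V \<in> carrier_mat s n"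
    and MN: "M = X * Y" "N = U * V" unfolding rank_le_def by blast
  have "M + N = beside X U * stack Y V" unfolding MN
    by (subst beside_times_stack[of _ n r _ s _ n]) (use c in auto)
  then show ?thesis unfolding rank_le_def using c by (intro exI[of _ "beside X U"] exI[of _ "stack Y V"]) auto
qed

lemma rank_le_mult:
  assumes "rank_le n r M" "P \<in> carrier_mat n n" "Q \<in> carrier_mat n n"
  shows "rank_le n r (P * M * Q)"
proof -
  from assms(1) obtain X Y where c: "X \<in> carrier_mat n r" "Y \<in> carrier_mat r n" and M: "M = X * Y"
    unfolding rank_le_def by blast
  have "P * M * Q = (P * X) * (Y * Q)" unfolding M using c assms
    by (simp add: assoc_mult_mat[of _ n n _ r _ n] assoc_mult_mat[of _ n r _ n _ n] assoc_mult_mat[of _ n n _ n _ n])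
  then show ?thesis unfolding rank_le_def using c assms by (intro exI[of _ "P * X"] exI[of _ "Y * Q"]) auto
qed

lemma rank_le_one:
  assumes "rank_le n r (1\<^sub>m n :: 'a::field mat)"
  shows "n \<le> r"
proof (rule ccontr)
  assume "\<not> n \<le> r"
  then have r: "r < n" by simp
  from assms obtain X Y :: "'a mat" where c: "X \<in> carrier_mat n r" "Y \<in> carrier_mat r n" and XY: "X * Y = 1\<^sub>m n"
    unfolding rank_le_def by metis
  let ?X = "beside X (0\<^sub>m n (n - r))" and ?Y = "stack Y (0\<^sub>m (n - r) n)"
  have cX: "?X \<in> carrier_mat n n" and cY: "?Y \<in> carrier_mat n n"
    using c r by (auto intro!: carrier_matI)
  have "?X * ?Y = 1\<^sub>m n"
    by (subst beside_times_stack[of _ n r _ "n - r" _ n]) (use c XY in auto)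
  from mat_mult_left_right_inverse[OF cX cY this]
  have "?Y * ?X = 1\<^sub>m n" .
  moreover have "?Y * ?X = four_block_mat (Y * X) (Y * 0\<^sub>m n (n - r)) (0\<^sub>m (n - r) n * X) (0\<^sub>m (n - r) n * 0\<^sub>m n (n - r))"
    by (rule stack_times_beside[of _ r n _ "n - r" _ r _ "n - r"]) (use c in auto)
  then have "(?Y * ?X) $$ (n - 1, n - 1) = 0"
    using c r by (simp add: left_mult_zero_mat[of _ n] right_mult_zero_mat[of _ _ n])
  ultimately show False using r by simp
qed

text \<open>
  Put \<open>A = C \<circ> e\<close>, \<open>M = A - 2\<close>, \<open>f = 1 - e\<close> and \<open>w = 2 - e\<close>.  Then \<open>f A f = 0\<close> gives \<open>f = -f M f / 2\<close>,
  and therefore \<open>C - 2 = w M w + (6 + f C) f\<close> is a sum of two multiples of \<open>M\<close>.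
\<close>

lemma rank_le_step:
  fixes C e :: "'a::field mat"
  assumes two: "(2::'a) \<noteq> 0" and C: "C \<in> carrier_mat n n" and e: "e \<in> carrier_mat n n" "e * e = e"
    and M: "rank_le n r (jordan_product C e - 2 \<cdot>\<^sub>m 1\<^sub>m n)"
  shows "rank_le n (2 * r) (C - 2 \<cdot>\<^sub>m 1\<^sub>m n)"
proof -
  note [simp] = minus_mult_distrib_mat[of _ n n _ _ n] mult_minus_distrib_mat[of _ n n _ n]
    mult_add_distrib_mat[of _ n n _ n] add_mult_distrib_mat[of _ n n _ _ n]
    mult_smult_distrib[of _ n n _ n] mult_smult_assoc_mat[of _ n n _ n]
  define A where "A = jordan_product C e"
  define M where "M = A - 2 \<cdot>\<^sub>m 1\<^sub>m n"
  define f where "f = 1\<^sub>m n - e"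
  define w where "w = 2 \<cdot>\<^sub>m 1\<^sub>m n - e"
  have c: "A \<in> carrier_mat n n" "f \<in> carrier_mat n n" "w \<in> carrier_mat n n" "M \<in> carrier_mat n n"
    using C e by (auto simp: A_def f_def w_def M_def)
  have ff: "f * f = f" unfolding f_def
    by (rule eq_matI) (use e in \<open>auto simp del: index_mult_mat(1)\<close>)
  have ww: "2 \<cdot>\<^sub>m (w * w) - 2 \<cdot>\<^sub>m 1\<^sub>m n = 6 \<cdot>\<^sub>m f" unfolding f_def w_def
    by (rule eq_matI) (use e in \<open>auto simp: algebra_simps simp del: index_mult_mat(1)\<close>)
  have AM: "A = 2 \<cdot>\<^sub>m 1\<^sub>m n + M" unfolding M_def by (rule eq_matI) (use c(1) in auto)
  have "f * A * f = 0\<^sub>m n n" using peirce_zero_component[OF C e] by (simp add: f_def A_def)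
  moreover have "f * A * f = 2 \<cdot>\<^sub>m f + f * M * f" unfolding AM using c ff by simp
  ultimately have z: "2 \<cdot>\<^sub>m f + f * M * f = 0\<^sub>m n n" by simp
  have fMf: "f * M * f = (- 2) \<cdot>\<^sub>m f"
  proof (rule eq_matI)
    fix i j assume "i < dim_row ((- 2) \<cdot>\<^sub>m f)" "j < dim_col ((- 2) \<cdot>\<^sub>m f)"
    then have ij: "i < n" "j < n" using c by auto
    have "(2 \<cdot>\<^sub>m f + f * M * f) $$ (i, j) = 0" unfolding z using ij by simp
    then show "(f * M * f) $$ (i, j) = ((- 2) \<cdot>\<^sub>m f) $$ (i, j)"
      using ij c by (simp add: eq_neg_iff_add_eq_0 add.commute del: index_mult_mat(1))
  qed (use c in auto)
  define P where "P = (- (1 / 2)) \<cdot>\<^sub>m ((6 \<cdot>\<^sub>m 1\<^sub>m n + f * C) * f)"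
  have P: "P \<in> carrier_mat n n" using c C by (simp add: P_def)
  have "P * M * f = (6 \<cdot>\<^sub>m 1\<^sub>m n + f * C) * f"
  proof -
    let ?N = "6 \<cdot>\<^sub>m 1\<^sub>m n + f * C"
    have N: "?N \<in> carrier_mat n n" using c C by simp
    have "P * M * f = (- (1 / 2)) \<cdot>\<^sub>m (?N * (f * M * f))"
      unfolding P_def using c N by (simp del: mult_add_distrib_mat add_mult_distrib_mat add: assoc_mult_mat[of _ n n _ n _ n])
    also have "\<dots> = ?N * f" unfolding fMf using N c two by (simp add: smult_smult_mat del: mult_add_distrib_mat add_mult_distrib_mat)
    finally show ?thesis .
  qed
  also have "\<dots> = 6 \<cdot>\<^sub>m f + f * C * f" using c C by simp
  finally have PM: "P * M * f = 6 \<cdot>\<^sub>m f + f * C * f" .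
  have "w * A * w = 2 \<cdot>\<^sub>m (w * w) + w * M * w" unfolding AM using c by simp
  then have C_eq: "C = 2 \<cdot>\<^sub>m (w * w) + w * M * w + f * C * f"
    using peirce_reconstruction[OF two C e] by (simp add: A_def w_def f_def)
  have "C - 2 \<cdot>\<^sub>m 1\<^sub>m n = w * M * w + P * M * f"
  proof (rule eq_matI)
    fix i j assume "i < dim_row (w * M * w + P * M * f)" "j < dim_col (w * M * w + P * M * f)"
    then have ij: "i < n" "j < n" using c carrier_matD[OF P] by auto
    have "(2 \<cdot>\<^sub>m (w * w) - 2 \<cdot>\<^sub>m 1\<^sub>m n) $$ (i, j) = (6 \<cdot>\<^sub>m f) $$ (i, j)" unfolding ww ..
    moreover have "C $$ (i, j) = (2 \<cdot>\<^sub>m (w * w) + w * M * w + f * C * f) $$ (i, j)" using C_eq by simp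
    ultimately show "(C - 2 \<cdot>\<^sub>m 1\<^sub>m n) $$ (i, j) = (w * M * w + P * M * f) $$ (i, j)"
      unfolding PM using ij c C by (simp add: algebra_simps del: index_mult_mat(1))
  qed (use c C P in auto)
  moreover have "rank_le n r M" using assms(5) by (simp add: M_def A_def)
  ultimately show ?thesis
    using rank_le_add[OF rank_le_mult rank_le_mult, of n r M w w r M P f] c P by (simp add: mult_2)
qed

text \<open>
  The base case is \<open>(e - 2) (e + 1) = -2\<close> for an idempotent \<open>e\<close>.  The scalar \<open>2\<close> is used
  because it differs from \<open>0\<close> and \<open>1\<close> in every field of characteristic not \<open>2\<close>.
\<close>

lemma word_length_ge:
  fixes A :: "'a::field mat"
  assumes two: "(2::'a) \<noteq> 0" and "A \<in> word_values n m" "rank_le n r (A - 2 \<cdot>\<^sub>m 1\<^sub>m n)"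
  shows "2 * n \<le> 2 ^ m * r"
  using assms(2,3)
proof (induction arbitrary: r rule: word_values_induct)
  case (idem e)
  have e: "e \<in> carrier_mat n n" "e * e = e" using idem(1) by (auto simp: idempotents_mat[OF two])
  have "(e - 2 \<cdot>\<^sub>m 1\<^sub>m n) * ((- (1 / 2)) \<cdot>\<^sub>m (e + 1\<^sub>m n)) = (- (1 / 2)) \<cdot>\<^sub>m (e * e - e - 2 \<cdot>\<^sub>m 1\<^sub>m n)"
    using e(1) by (intro eq_matI) (auto simp: minus_mult_distrib_mat[of _ n n _ _ n]
      mult_add_distrib_mat[of _ n n _ n] mult_smult_distrib[of _ n n _ n] mult_smult_assoc_mat[of _ n n _ n]
      algebra_simps simp del: index_mult_mat(1))
  also have "\<dots> = 1\<^sub>m n" unfolding e(2) by (rule eq_matI) (use e(1) two in auto)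
  finally have "1\<^sub>m n * (e - 2 \<cdot>\<^sub>m 1\<^sub>m n) * ((- (1 / 2)) \<cdot>\<^sub>m (e + 1\<^sub>m n)) = 1\<^sub>m n"
    using left_mult_one_mat[of "e - 2 \<cdot>\<^sub>m 1\<^sub>m n" n n] by simp
  with rank_le_mult[OF idem(2) one_carrier_mat, of "(- (1 / 2)) \<cdot>\<^sub>m (e + 1\<^sub>m n)"]
  have "rank_le n r (1\<^sub>m n :: 'a mat)" using e by simp
  from rank_le_one[OF this] show ?case by simp
next
  case (Suc m C e)
  then have "rank_le n (2 * r) (C - 2 \<cdot>\<^sub>m 1\<^sub>m n)"
    by (intro rank_le_step[OF two word_values_carrier]) (auto simp: idempotents_mat[OF two])
  from Suc.IH[OF this] show ?case by simp
qed

text \<open>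
  For \<open>c \<noteq> 0\<close> the vanishing of the second diagonal block \<open>c (1 - e)\<close> of a product forces \<open>e = 1\<close>.
\<close>

lemma scalar_word_value:
  fixes c :: "'a::field"
  assumes two: "(2::'a) \<noteq> 0" and n: "n \<ge> 1" and "A \<in> word_values n m" "A = c \<cdot>\<^sub>m 1\<^sub>m n"
  shows "c = 0 \<or> c = 1"
  using assms(3,4)
proof (induction rule: word_values_induct)
  case (idem e)
  then have "e * e = e" by (auto simp: idempotents_mat[OF two])
  then have "(e * e) $$ (0, 0) = e $$ (0, 0)" by simp
  then have "c * c = c" using n idem(2)
    by (simp add: mult_smult_distrib[of _ n n _ n] mult_smult_assoc_mat[of _ n n _ n] del: index_mult_mat(1))
  then show ?case by simp
next
  case (Suc m C e)
  have C: "C \<in> carrier_mat n n" by (rule word_values_carrier[OF Suc.hyps(1)])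
  have e: "e \<in> carrier_mat n n" "e * e = e" using Suc.hyps(2) by (auto simp: idempotents_mat[OF two])
  let ?f = "1\<^sub>m n - e"
  have f: "?f \<in> carrier_mat n n" using e by simp
  show ?case
  proof (cases "c = 0")
    case False
    have ff: "?f * ?f = ?f"
      by (rule eq_matI) (use e in \<open>auto simp: minus_mult_distrib_mat[of _ n n _ _ n] mult_minus_distrib_mat[of _ n n _ n] simp del: index_mult_mat(1)\<close>)
    have "?f * (c \<cdot>\<^sub>m 1\<^sub>m n) * ?f = c \<cdot>\<^sub>m (?f * ?f)"
      using f right_mult_one_mat[OF f] by (simp add: mult_smult_distrib[of _ n n _ n] mult_smult_assoc_mat[of _ n n _ n])
    then have cf: "c \<cdot>\<^sub>m ?f = 0\<^sub>m n n"
      using peirce_zero_component[OF C e] unfolding Suc.prems ff by simp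
    have "e = 1\<^sub>m n"
    proof (rule eq_matI)
      fix i j assume "i < dim_row (1\<^sub>m n :: 'a mat)" "j < dim_col (1\<^sub>m n :: 'a mat)"
      then have ij: "i < n" "j < n" by auto
      have "(c \<cdot>\<^sub>m ?f) $$ (i, j) = 0" unfolding cf using ij by simp
      then show "e $$ (i, j) = 1\<^sub>m n $$ (i, j)" using ij e False by simp
    qed (use e in auto)
    then have "C = c \<cdot>\<^sub>m 1\<^sub>m n" using Suc.prems jordan_product_one[OF two C] by simp
    then show ?thesis by (rule Suc.IH)
  qed simp
qed

section \<open>The width\<close>

lemma idempotent_products_word_values:
  "idempotent_products (carrier_mat n n) jordan_product = (\<Union>m. word_values n m)"
  unfolding idempotent_products_def word_values_def by auto

lemma idempotent_length_word_values:
  "idempotent_length (carrier_mat n n) jordan_product x = (LEAST m. x \<in> word_values n m)"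
  unfolding idempotent_length_def word_values_def by (rule arg_cong[where f = Least]) auto

lemma le_power_ceiling_log: "n \<ge> 1 \<Longrightarrow> n \<le> 2 ^ nat \<lceil>log 2 (real n)\<rceil>"
proof -
  assume n: "n \<ge> 1"
  have "real n = 2 powr log 2 (real n)" using n by simp
  also have "\<dots> \<le> 2 powr real (nat \<lceil>log 2 (real n)\<rceil>)" by (intro powr_mono) linarith+
  also have "\<dots> = real (2 ^ nat \<lceil>log 2 (real n)\<rceil>)" by (simp add: powr_realpow)
  finally show ?thesis by (simp only: of_nat_le_iff)
qed

lemma ceiling_log_le: "n \<ge> 1 \<Longrightarrow> n \<le> 2 ^ a \<Longrightarrow> nat \<lceil>log 2 (real n)\<rceil> \<le> a"
proof -
  assume n: "n \<ge> 1" "n \<le> 2 ^ a"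
  from n(2) have "real n \<le> real (2 ^ a)" by (simp only: of_nat_le_iff)
  then have "real n \<le> 2 powr real a" by (simp add: powr_realpow)
  then have "log 2 (real n) \<le> real a" using n by (simp add: log_le_iff)
  then show ?thesis by linarith
qed

theorem theorem1p2:
  fixes n :: nat
  assumes "CHAR('a::field) \<noteq> 2" and "n \<ge> 2"
  shows
    "idempotent_products (carrier_mat n n) (jordan_product :: 'a mat \<Rightarrow> 'a mat \<Rightarrow> 'a mat) =
       (carrier_mat n n - {c \<cdot>\<^sub>m 1\<^sub>m n | c. True}) \<union> {0\<^sub>m n n, 1\<^sub>m n}
     \<and> enat (1 + nat \<lceil>log 2 (real n)\<rceil>)
         \<le> idempotent_width (carrier_mat n n) (jordan_product :: 'a mat \<Rightarrow> 'a mat \<Rightarrow> 'a mat)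
     \<and> idempotent_width (carrier_mat n n) (jordan_product :: 'a mat \<Rightarrow> 'a mat \<Rightarrow> 'a mat)
         \<le> enat (2 + 5 * nat \<lceil>log 2 (real n)\<rceil>)
     \<and> (quadratically_closed TYPE('a) \<longrightarrow>
         idempotent_width (carrier_mat n n) (jordan_product :: 'a mat \<Rightarrow> 'a mat \<Rightarrow> 'a mat)
           \<le> enat (4 + 3 * nat \<lceil>log 2 (real n)\<rceil>))"
proof -
  have two: "(2::'a) \<noteq> 0" by (rule two_neq_zero[OF assms(1)])
  define L where "L = nat \<lceil>log 2 (real n)\<rceil>"
  let ?W = "word_values n :: nat \<Rightarrow> 'a mat set"
  let ?w = "idempotent_width (carrier_mat n n) (jordan_product :: 'a mat \<Rightarrow> 'a mat \<Rightarrow> 'a mat)"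
  have nL: "n \<le> 2 ^ L" unfolding L_def using assms(2) by (intro le_power_ceiling_log) simp
  then have L: "1 \<le> L" using assms(2) by (cases L) auto
  have nonscalar: "x \<in> ?W (4 + 3 * L)" if "x \<in> carrier_mat n n" "\<nexists>c. x = c \<cdot>\<^sub>m 1\<^sub>m n" for x
    by (rule word_values_nonscalar[OF two that(1) assms(2) that(2) nL])
  have idem: "0\<^sub>m n n \<in> ?W 1" "1\<^sub>m n \<in> ?W 1"
    by (rule word_values_1, simp add: idempotents_mat[OF two])+
  have scalar: "x = 0\<^sub>m n n \<or> x = 1\<^sub>m n" if "x \<in> ?W m" "x = c \<cdot>\<^sub>m 1\<^sub>m n" for x c m
  proof -
    have "c = 0 \<or> c = 1" using scalar_word_value[OF two _ that] assms(2) by simp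
    moreover have "0 \<cdot>\<^sub>m 1\<^sub>m n = (0\<^sub>m n n :: 'a mat)" by (rule eq_matI) auto
    ultimately show ?thesis using that(2) by auto
  qed
  have products: "idempotent_products (carrier_mat n n) (jordan_product :: 'a mat \<Rightarrow> 'a mat \<Rightarrow> 'a mat) =
      (carrier_mat n n - {c \<cdot>\<^sub>m 1\<^sub>m n | c. True}) \<union> {0\<^sub>m n n, 1\<^sub>m n}"
    unfolding idempotent_products_word_values
    using nonscalar idem scalar word_values_carrier by blast
  have short: "x \<in> ?W (4 + 3 * L)" if "x \<in> ?W m" for x m
  proof (cases "\<exists>c. x = c \<cdot>\<^sub>m 1\<^sub>m n")
    case True
    then obtain c where "x = c \<cdot>\<^sub>m 1\<^sub>m n" by blast
    from scalar[OF that this] have "x \<in> ?W 1" using idem by blast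
    then show ?thesis using word_values_mono[OF two, of 1 "4 + 3 * L" n] by auto
  next
    case False
    then show ?thesis using nonscalar word_values_carrier[OF that] by blast
  qed
  have upper: "?w \<le> enat (4 + 3 * L)"
    unfolding idempotent_width_def idempotent_products_word_values idempotent_length_word_values
    by (rule SUP_least) (auto intro!: Least_le short)
  have lower: "enat (1 + L) \<le> ?w"
  proof -
    define E where "E = mat n n (\<lambda>(i, j). if i = 0 \<and> j = n - 1 then 1 else (0::'a))"
    define x where "x = 2 \<cdot>\<^sub>m 1\<^sub>m n + E"
    have x: "x \<in> carrier_mat n n" by (simp add: x_def E_def)
    have "\<nexists>c. x = c \<cdot>\<^sub>m 1\<^sub>m n"
    proof
      assume "\<exists>c. x = c \<cdot>\<^sub>m 1\<^sub>m n"
      then have "x $$ (0, n - 1) = 0" using assms(2) by auto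
      then show False using assms(2) by (simp add: x_def E_def)
    qed
    then have xW: "x \<in> ?W (4 + 3 * L)" using nonscalar x by blast
    have "E = mat n 1 (\<lambda>(i, j). if i = 0 then 1 else 0) * mat 1 n (\<lambda>(i, j). if j = n - 1 then 1 else 0)"
      by (rule eq_matI) (auto simp: E_def scalar_prod_def)
    moreover have "x - 2 \<cdot>\<^sub>m 1\<^sub>m n = E" by (rule eq_matI) (auto simp: x_def E_def)
    ultimately have "rank_le n 1 (x - 2 \<cdot>\<^sub>m 1\<^sub>m n)" unfolding rank_le_def by (metis mat_carrier)
    then have pow: "2 * n \<le> 2 ^ m" if "x \<in> ?W m" for m using word_length_ge[OF two that] by fastforce
    have "1 + L \<le> m" if "x \<in> ?W m" for m
    proof -
      have *: "2 * n \<le> 2 ^ m" using pow that .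
      then obtain a where a: "m = Suc a" using assms(2) by (cases m) auto
      then have "L \<le> a" unfolding L_def using * assms(2) by (intro ceiling_log_le) auto
      then show ?thesis using a by simp
    qed
    then have "1 + L \<le> idempotent_length (carrier_mat n n) jordan_product x"
      unfolding idempotent_length_word_values using xW by (metis (mono_tags) LeastI)
    then have "enat (1 + L) \<le> enat (idempotent_length (carrier_mat n n) jordan_product x)" by simp
    also have "\<dots> \<le> ?w" unfolding idempotent_width_def idempotent_products_word_values
      by (rule SUP_upper) (use xW in auto)
    finally show ?thesis .
  qed
  have "?w \<le> enat (2 + 5 * L)" by (rule order_trans[OF upper]) (use L in simp)
  with products lower upper show ?thesis unfolding L_def by blast
qed

end
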